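(* Let $A\subseteq\mathbb{N}$ satisfy $H_1(A)=\{0\}$, and let $\{A_k\}_{k\ge1}$ be a sequence of finite nonempty subsets of $A$ such that $$\max A_k<\min A_{k+1}\qquad\text{for all }k\ge1,$$ and $A\setminus\bigcup_{k\ge1}A_k$ is finite. For each $k\ge1$, define $\alpha_k:=\min A_k$ and $\beta_k:=\max A_k$, and assume that there exist $k_0,r\in\mathbb{N}$ and sequences of nonnegative integers $\{r_{1,k}\}_{k\ge k_0}$ and $\{r_{2,k}\}_{k\ge k_0}$, each positive for infinitely many $k$, such that $$r_{1,k}+r_{2,k}=r\quad\text{for all }k\ge k_0,\qquad |A_k|\ge r+1\quad\text{for all }k\ge k_0,$$ $$\sup_{k\ge k_0}\frac{\alpha_{k+1}}{\alpha_k}<\infty,$$ and $$\sup_{k\ge k_0}\left(\beta_k-\sum_{\ell=k_0}^{k-1}r_{i,\ell}\,\alpha_\ell\right)<\infty\qquad\text{for }i=1,2.$$ Then $A$ is strongly complete.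
   Context: $\mathbb{N}=\{1,2,3,\ldots\}$ and $\mathbb{T}=\mathbb{R}/\mathbb{Z}$. $\|x\|$ denotes the distance from $x$ to the nearest integer. For $S\subseteq\mathbb{Z}$, $H_1(S):=\{\theta\in\mathbb{T}:\sum_{s\in S}\|s\theta\|<\infty\}$. A set $A\subseteq\mathbb{N}$ is complete if every sufficiently large positive integer is a sum of distinct elements of $A$, and strongly complete if $A\setminus B$ is complete for every finite subset $B\subseteq A$. *)

theory Defs
  imports "HOL-Analysis.Analysis"
begin

definition dist_nearest_int :: "real \<Rightarrow> real" where
  "dist_nearest_int x = \<bar>x - of_int (round x)\<bar>"

lemma dist_nearest_int_add_of_int:
  "dist_nearest_int (x + of_int n) = dist_nearest_int x"
proof -
  have "round (x + of_int n) = round x + n"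
    using floor_add_int[of "x + 1 / 2" n] by (simp add: round_def algebra_simps)
  then show ?thesis
    by (simp add: dist_nearest_int_def)
qed

text \<open>The circle group \<open>\<real>/\<int>\<close>.\<close>

quotient_type circle = real / "\<lambda>x y :: real. x - y \<in> \<int>"
proof (rule equivpI)
  show "reflp (\<lambda>x y :: real. x - y \<in> \<int>)"
    by (simp add: reflp_def)
  show "symp (\<lambda>x y :: real. x - y \<in> \<int>)"
  proof (rule sympI)
    fix x y :: real
    assume "x - y \<in> \<int>"
    then have "- (x - y) \<in> \<int>"
      by (rule Ints_minus)
    then show "y - x \<in> \<int>"
      by simp
  qed
  show "transp (\<lambda>x y :: real. x - y \<in> \<int>)"
  proof (rule transpI)
    fix x y z :: real
    assume "x - y \<in> \<int>" "y - z \<in> \<int>"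
    then have "(x - y) + (y - z) \<in> \<int>"
      by (rule Ints_add)
    then show "x - z \<in> \<int>"
      by simp
  qed
qed

instantiation circle :: zero
begin

lift_definition zero_circle :: circle is "0 :: real" .

instance ..

end

lift_definition circle_mult :: "int \<Rightarrow> circle \<Rightarrow> circle" is "\<lambda>s x. of_int s * x"
proof -
  fix s :: int and x y :: real
  assume "x - y \<in> \<int>"
  then have "of_int s * (x - y) \<in> \<int>"
    by simp
  then show "of_int s * x - of_int s * y \<in> \<int>"
    by (simp add: right_diff_distrib)
qed

lift_definition circle_norm :: "circle \<Rightarrow> real" is dist_nearest_int
proof -
  fix x y :: real
  assume "x - y \<in> \<int>"
  then obtain n where "x - y = of_int n"
    by (rule Ints_cases)
  then have "x = y + of_int n"
    by simp
  then show "dist_nearest_int x = dist_nearest_int y"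
    by (simp add: dist_nearest_int_add_of_int)
qed

text \<open>The terms are nonnegative, so unconditional summability over \<open>S\<close> is finiteness of the sum.\<close>

definition H1 :: "int set \<Rightarrow> circle set" where
  "H1 S = {\<theta>. (\<lambda>s. circle_norm (circle_mult s \<theta>)) summable_on S}"

text \<open>The next two notions are meant for sets of positive integers, that is, for \<open>0 \<notin> A\<close>.\<close>

definition complete_set :: "nat set \<Rightarrow> bool" where
  "complete_set A \<longleftrightarrow> (\<forall>\<^sub>F n in sequentially. \<exists>F. finite F \<and> F \<subseteq> A \<and> n = \<Sum>F)"

definition strongly_complete :: "nat set \<Rightarrow> bool" where
  "strongly_complete A \<longleftrightarrow> (\<forall>B. finite B \<and> B \<subseteq> A \<longrightarrow> complete_set (A - B))"

end

theory Submission
  imports Defs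
begin

text \<open>
  Given a finite set to be removed from \<open>A\<close>, start the sequence of blocks so late that it avoids this set.
  From the remaining blocks, three disjoint sets \<open>E1\<close>, \<open>E2\<close>, \<open>U\<close> are selected, where \<open>Ei\<close> takes \<open>ri k\<close>
  elements of the \<open>k\<close>-th block.

  By the growth hypothesis the maximum of a block exceeds the sum of all elements of \<open>Ei\<close> selected before
  it by at most a constant \<open>c\<close>. Hence a greedy choice shows that the subset sums of \<open>Ei\<close> have gaps of
  length at most \<open>c\<close> (\<open>selection_gaps\<close>). It remains to find a finite \<open>V \<subseteq> U\<close> such that the subset sums of
  \<open>E1 \<union> V\<close> contain \<open>c + 1\<close> consecutive integers: adding the subset sums of \<open>E2\<close> to them covers
  everything from some point on (\<open>block_sums_complete\<close>).

  Runs of consecutive integers come from density. Let \<open>\<delta>\<close> be the supremum of the densities (in suitable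
  long windows) of the sets \<open>W\<close> of subset sums of \<open>E1 \<union> V\<close>, for finite \<open>V \<subseteq> U\<close>. If \<open>W\<close> almost attains
  \<open>\<delta>\<close>, then a translate of \<open>W\<close> by a sum of elements of \<open>U\<close> outside \<open>V\<close> is essentially contained in \<open>W\<close>,
  since otherwise enlarging \<open>V\<close> would raise the density above \<open>\<delta>\<close>. Fourier analysis on a long window,
  seen as a cyclic group, turns this near invariance into smallness of the Fourier mass of \<open>W\<close> at every
  frequency \<open>\<theta>\<close> that some such sum \<open>t\<close> \<^emph>\<open>detects\<close>, meaning that \<open>t\<theta>\<close> is at distance at least some fixed
  \<open>\<epsilon>\<close> from the integers. Frequencies close to \<open>0\<close> carry little mass because no long window of \<open>W\<close> has
  density much above \<open>\<delta>\<close>. So if \<open>U\<close> detects all other frequencies, the variance \<open>\<delta>(1 - \<delta>)\<close> is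
  arbitrarily small, and \<open>\<delta> = 1\<close> (\<open>subset_sums_density_saturates\<close>).

  The remaining task is to choose a detecting \<open>U\<close> that leaves \<open>r\<close> elements in each block
  (\<open>detecting_set\<close>). Triviality of \<open>H1\<close> says that \<open>A\<close> detects each single nonzero frequency, but the choice
  has to work for uncountably many frequencies at once. Here the bounded ratio of the block minima
  \<open>\<alpha> k\<close> enters: if \<open>\<alpha> k \<theta>\<close> is close to an integer for all \<open>k \<ge> K\<close>, then each of these integers determines
  the next one, so only finitely many \<open>\<theta>\<close> in the unit interval evade detection by the minima. The same
  rigidity holds if minima are dropped from a set of blocks no two of which are adjacent. The
  finitely many evading frequencies are therefore treated one after another: each is detected by a sum
  with elements from blocks of one parity and of one out of \<open>r + 1\<close> colours, while the minima of the
  untouched blocks keep every other undetected frequency extremely close to one of those treated.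
\<close>

section \<open>Distance to the nearest integer\<close>

lemma dist_nearest_int_le: "dist_nearest_int x \<le> \<bar>x - of_int n\<bar>"
  unfolding dist_nearest_int_def by (rule round_diff_minimal)

lemma dist_nearest_int_lipschitz: "dist_nearest_int x \<le> dist_nearest_int y + \<bar>x - y\<bar>"
  using dist_nearest_int_le[of x "round y"] by (simp add: dist_nearest_int_def)

lemma dist_nearest_int_le_half: "dist_nearest_int x \<le> 1 / 2"
  using of_int_round_abs_le[of x] by (simp add: dist_nearest_int_def abs_minus_commute)

lemma continuous_on_dist_nearest_int: "continuous_on S dist_nearest_int"
  unfolding continuous_on_iff
proof (intro ballI allI impI)
  fix x e :: real assume "e > 0"
  moreover have "dist (dist_nearest_int y) (dist_nearest_int x) \<le> dist y x" for y
    using dist_nearest_int_lipschitz[of x y] dist_nearest_int_lipschitz[of y x]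
    by (simp add: dist_real_def abs_minus_commute)
  ultimately show "\<exists>d>0. \<forall>y\<in>S. dist y x < d \<longrightarrow> dist (dist_nearest_int y) (dist_nearest_int x) < e"
    by (meson le_less_trans)
qed

lemma norm_one_plus_cis: "cmod (1 + cis (2 * a)) = 2 * \<bar>cos a\<bar>"
proof -
  have "1 + cis (2 * a) = of_real (2 * cos a) * cis a"
    by (simp add: complex_eq_iff cos_double_cos sin_double power2_eq_square)
  then show ?thesis by (simp add: norm_mult)
qed

lemma norm_one_minus_cis_le: "cmod (1 - cis a) \<le> \<bar>a\<bar>"
proof (rule power2_le_imp_le)
  have "(cmod (1 - cis a))\<^sup>2 = 2 - 2 * cos a"
    using sin_cos_squared_add[of a] by (simp add: cmod_power2 power2_diff)
  also have "\<dots> = 4 * (sin (a / 2))\<^sup>2"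
    using cos_double_sin[of "a / 2"] by simp
  also have "\<dots> \<le> 4 * (a / 2)\<^sup>2"
    using abs_sin_x_le_abs_x[of "a / 2"] by (intro mult_left_mono) (simp_all only: abs_le_square_iff)
  finally show "(cmod (1 - cis a))\<^sup>2 \<le> \<bar>a\<bar>\<^sup>2"
    by (simp add: power_divide)
qed simp

lemma abs_cos_le_of_dist_nearest_int:
  assumes "0 \<le> e" "e \<le> dist_nearest_int x"
  shows "\<bar>cos (pi * x)\<bar> \<le> cos (pi * e)"
proof -
  define y where "y = x - of_int (round x)"
  have y: "e \<le> \<bar>y\<bar>" "\<bar>y\<bar> \<le> 1 / 2"
    using assms dist_nearest_int_le_half[of x] by (simp_all add: y_def dist_nearest_int_def)
  have "cos (pi * x) = cos (pi * y + pi * of_int (round x))"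
    by (simp add: y_def algebra_simps)
  also have "\<bar>\<dots>\<bar> = \<bar>cos (pi * y)\<bar>"
    by (simp add: cos_add sin_npi_int abs_mult)
  also have "cos (pi * y) = cos (pi * \<bar>y\<bar>)"
    by (cases "y \<ge> 0") auto
  also have "\<bar>cos (pi * \<bar>y\<bar>)\<bar> = cos (pi * \<bar>y\<bar>)"
    using y by (intro abs_of_nonneg cos_ge_zero) (auto intro: order_trans[of _ 0] simp: field_simps)
  also have "\<dots> \<le> cos (pi * e)"
    using assms y by (intro cos_monotone_0_pi_le) (auto simp: field_simps)
  finally show ?thesis .
qed

section \<open>Finite Fourier analysis of averages of translates\<close>

definition periodic :: "nat \<Rightarrow> (int \<Rightarrow> 'a) \<Rightarrow> bool" where
  "periodic Q f \<longleftrightarrow> (\<forall>y. f (y + int Q) = f y)"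

lemma periodic_multiple:
  assumes "periodic Q f"
  shows "f (y + k * int Q) = f y"
proof (induction k rule: int_induct[where k = 0])
  case base
  show ?case by simp
next
  case (step1 i)
  have "f (y + (i + 1) * int Q) = f ((y + i * int Q) + int Q)"
    by (simp add: algebra_simps)
  then show ?case
    using assms step1 by (metis periodic_def)
next
  case (step2 i)
  have "f (y + i * int Q) = f ((y + (i - 1) * int Q) + int Q)"
    by (simp add: algebra_simps)
  then show ?case
    using assms step2 by (metis periodic_def)
qed

lemma periodic_mod:
  assumes "periodic Q f"
  shows "f (y mod int Q) = f y"
  using periodic_multiple[OF assms, of "y mod int Q" "y div int Q"]
  by (simp add: mod_div_mult_eq)

lemma sum_period_shift:
  fixes f :: "int \<Rightarrow> 'a :: comm_monoid_add"
  assumes "Q > 0" "periodic Q f"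
  shows "(\<Sum>y\<in>{0..<int Q}. f (y - t)) = (\<Sum>y\<in>{0..<int Q}. f y)"
proof (rule sum.reindex_bij_witness[where i = "\<lambda>y. (y + t) mod int Q" and j = "\<lambda>y. (y - t) mod int Q"])
  fix y assume "y \<in> {0..<int Q}"
  then show "((y - t) mod int Q + t) mod int Q = y" "((y + t) mod int Q - t) mod int Q = y"
    by (simp_all add: mod_simps)
qed (use assms periodic_mod[OF assms(2)] in auto)

definition dft :: "nat \<Rightarrow> (int \<Rightarrow> complex) \<Rightarrow> nat \<Rightarrow> complex" where
  "dft Q f j = (\<Sum>y\<in>{0..<int Q}. f y * cis (- (2 * pi * (real j / real Q) * of_int y)))"

lemma sum_characters:
  assumes "Q > 0"
  shows "(\<Sum>j<Q. cis (2 * pi * (real j / real Q) * of_int d)) = (if int Q dvd d then of_nat Q else 0)"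
proof -
  define w where "w = cis (2 * pi * of_int d / real Q)"
  have pow: "cis (2 * pi * (real j / real Q) * of_int d) = w ^ j" for j
    unfolding w_def Complex.DeMoivre by (rule arg_cong[where f = cis]) simp
  have wQ: "w ^ Q = 1"
    using assms by (simp add: w_def Complex.DeMoivre)
  show ?thesis
  proof (cases "int Q dvd d")
    case True
    then obtain e where "d = int Q * e" ..
    then have "w = 1"
      using assms cis_multiple_2pi[of "of_int e"] by (simp add: w_def mult_ac)
    then show ?thesis
      using True unfolding pow by simp
  next
    case False
    have "w \<noteq> 1"
    proof
      assume "w = 1"
      then obtain n :: int where "2 * pi * of_int d / real Q = 2 * pi * of_int n"
        unfolding w_def cis_conv_exp exp_eq_1 by (auto simp: mult_ac)
      then have "of_int d = real Q * of_int n"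
        using assms by (simp add: field_simps)
      then have "real_of_int d = of_int (int Q * n)" by simp
      then have "d = int Q * n" by (simp only: of_int_eq_iff)
      with False show False by simp
    qed
    then show ?thesis
      using False wQ unfolding pow by (simp add: sum_gp_strict)
  qed
qed

lemma parseval:
  assumes "Q > 0"
  shows "(\<Sum>j<Q. (cmod (dft Q f j))\<^sup>2) = real Q * (\<Sum>y\<in>{0..<int Q}. (cmod (f y))\<^sup>2)"
proof -
  let ?R = "{0..<int Q}"
  have "(\<Sum>j<Q. dft Q f j * cnj (dft Q f j)) =
    (\<Sum>j<Q. \<Sum>y\<in>?R. \<Sum>z\<in>?R. f y * cnj (f z) * cis (2 * pi * (real j / real Q) * of_int (z - y)))"
    unfolding dft_def cnj_sum sum_product
  proof (intro sum.cong refl)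
    fix j and y z :: int
    have "cis (- (2 * pi * (real j / real Q) * of_int y)) * cis (2 * pi * (real j / real Q) * of_int z)
      = cis (2 * pi * (real j / real Q) * of_int (z - y))"
      unfolding cis_mult by (rule arg_cong[where f = cis]) (simp add: ring_distribs add_divide_distrib diff_divide_distrib)
    then show "f y * cis (- (2 * pi * (real j / real Q) * of_int y)) *
      cnj (f z * cis (- (2 * pi * (real j / real Q) * of_int z))) =
      f y * cnj (f z) * cis (2 * pi * (real j / real Q) * of_int (z - y))"
      by (simp only: complex_cnj_mult cis_cnj minus_minus mult_ac)
  qed
  also have "\<dots> = (\<Sum>y\<in>?R. \<Sum>z\<in>?R. \<Sum>j<Q. f y * cnj (f z) * cis (2 * pi * (real j / real Q) * of_int (z - y)))"
    by (subst sum.swap, intro sum.cong refl, rule sum.swap)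
  also have "\<dots> = (\<Sum>y\<in>?R. \<Sum>z\<in>?R. if z = y then f y * cnj (f z) * of_nat Q else 0)"
  proof (intro sum.cong refl)
    fix y z assume yz: "y \<in> ?R" "z \<in> ?R"
    have "int Q dvd z - y \<longleftrightarrow> z = y"
    proof
      assume "int Q dvd z - y"
      then have "z mod int Q = y mod int Q" by (simp add: mod_eq_dvd_iff)
      then show "z = y" using yz by simp
    qed simp
    then show "(\<Sum>j<Q. f y * cnj (f z) * cis (2 * pi * (real j / real Q) * of_int (z - y))) =
      (if z = y then f y * cnj (f z) * of_nat Q else 0)"
      using sum_characters[OF assms, of "z - y"] by (simp flip: sum_distrib_left)
  qed
  also have "\<dots> = of_nat Q * (\<Sum>y\<in>?R. f y * cnj (f y))"
    by (simp add: sum_distrib_left mult_ac)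
  finally have "complex_of_real (\<Sum>j<Q. (cmod (dft Q f j))\<^sup>2) =
    complex_of_real (real Q * (\<Sum>y\<in>?R. (cmod (f y))\<^sup>2))"
    by (simp only: of_real_sum of_real_mult of_real_of_nat_eq complex_norm_square)
  then show ?thesis
    by (simp only: of_real_eq_iff)
qed

lemma dft_diff: "dft Q (\<lambda>y. f y - g y) j = dft Q f j - dft Q g j"
  by (simp add: dft_def left_diff_distrib sum_subtractf)

definition mean_translate :: "'i set \<Rightarrow> ('i \<Rightarrow> int) \<Rightarrow> (int \<Rightarrow> complex) \<Rightarrow> int \<Rightarrow> complex" where
  "mean_translate I s f y = (\<Sum>i\<in>I. f (y - s i)) / of_nat (card I)"

definition mean_character :: "'i set \<Rightarrow> ('i \<Rightarrow> int) \<Rightarrow> real \<Rightarrow> complex" where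
  "mean_character I s \<theta> = (\<Sum>i\<in>I. cis (- (2 * pi * \<theta> * of_int (s i)))) / of_nat (card I)"

lemma dft_translate:
  assumes "Q > 0" "periodic Q f"
  shows "dft Q (\<lambda>y. f (y - t)) j = cis (- (2 * pi * (real j / real Q) * of_int t)) * dft Q f j"
proof -
  let ?e = "\<lambda>y. cis (- (2 * pi * (real j / real Q) * of_int y))"
  have e_add: "?e (y + z) = ?e y * ?e z" for y z
    unfolding cis_mult by (rule arg_cong[where f = cis]) (simp add: ring_distribs add_divide_distrib diff_divide_distrib)
  have "?e (int Q) = cis (2 * pi * (- real j))"
    using assms(1) by (intro arg_cong[where f = cis]) simp
  also have "\<dots> = 1"
    by (rule cis_multiple_2pi) simp
  finally have "?e (y + int Q) = ?e y" for y
    unfolding e_add by simp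
  then have per: "periodic Q (\<lambda>y. f y * ?e y)"
    using assms(2) by (simp add: periodic_def)
  have "f (y - t) * ?e y = ?e t * (f (y - t) * ?e (y - t))" for y
    using e_add[of "y - t" t] by (simp add: mult_ac)
  then show ?thesis
    unfolding dft_def
    by (simp only: sum_distrib_left[symmetric] sum_period_shift[OF assms(1) per, of t])
qed

lemma dft_mean_translate:
  assumes "Q > 0" "periodic Q f"
  shows "dft Q (mean_translate I s f) j = mean_character I s (real j / real Q) * dft Q f j"
proof -
  have "dft Q (mean_translate I s f) j = (\<Sum>i\<in>I. dft Q (\<lambda>y. f (y - s i)) j) / of_nat (card I)"
    unfolding dft_def mean_translate_def sum_divide_distrib sum_distrib_right
    by (subst sum.swap) (simp add: sum_divide_distrib)
  then show ?thesis
    by (simp add: dft_translate[OF assms] mean_character_def sum_distrib_right)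
qed

text \<open>
  Averaging over translates multiplies the Fourier coefficients by the mean characters. At each nonzero
  frequency either the first average changes the coefficient by a factor bounded away from \<open>1\<close>, or the second
  one preserves at least half of it. So Parseval bounds \<open>f\<close> by the part that the first average
  moves and the part that the second one keeps.
\<close>

lemma norm_bound_by_translates:
  assumes Q: "Q > 0" and per: "periodic Q f" and mean: "(\<Sum>y\<in>{0..<int Q}. f y) = 0"
    and c: "c > 0"
    and dich: "\<And>j. 0 < j \<Longrightarrow> j < Q \<Longrightarrow> c \<le> cmod (1 - mean_character I s (real j / real Q))
      \<or> 1 / 2 \<le> cmod (mean_character J u (real j / real Q))"
  shows "(\<Sum>y\<in>{0..<int Q}. (cmod (f y))\<^sup>2) \<le>
    (\<Sum>y\<in>{0..<int Q}. (cmod (f y - mean_translate I s f y))\<^sup>2) / c\<^sup>2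
    + 4 * (\<Sum>y\<in>{0..<int Q}. (cmod (mean_translate J u f y))\<^sup>2)"
proof -
  let ?g = "\<lambda>y. f y - mean_translate I s f y"
  let ?h = "mean_translate J u f"
  have g: "dft Q ?g j = (1 - mean_character I s (real j / real Q)) * dft Q f j" for j
    by (simp add: dft_diff dft_mean_translate[OF Q per] algebra_simps)
  have h: "dft Q ?h j = mean_character J u (real j / real Q) * dft Q f j" for j
    by (simp add: dft_mean_translate[OF Q per])
  have pt: "(cmod (dft Q f j))\<^sup>2 \<le> (cmod (dft Q ?g j))\<^sup>2 / c\<^sup>2 + 4 * (cmod (dft Q ?h j))\<^sup>2"
    if "j < Q" for j
  proof (cases "j = 0")
    case True
    then have "dft Q f j = 0" using mean by (simp add: dft_def)
    then show ?thesis by simp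
  next
    case False
    with dich[of j] that consider
        "c \<le> cmod (1 - mean_character I s (real j / real Q))"
      | "1 / 2 \<le> cmod (mean_character J u (real j / real Q))" by auto
    then show ?thesis
    proof cases
      case 1
      then have "c\<^sup>2 * (cmod (dft Q f j))\<^sup>2 \<le> (cmod (dft Q ?g j))\<^sup>2"
        using c unfolding g norm_mult power_mult_distrib
        by (intro mult_right_mono power_mono) auto
      then have "(cmod (dft Q f j))\<^sup>2 \<le> (cmod (dft Q ?g j))\<^sup>2 / c\<^sup>2"
        using c by (simp add: field_simps)
      then show ?thesis by (smt (verit) zero_le_power2)
    next
      case 2
      then have *: "(1 / 2)\<^sup>2 * (cmod (dft Q f j))\<^sup>2 \<le> (cmod (dft Q ?h j))\<^sup>2"
        unfolding h norm_mult power_mult_distrib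
        by (intro mult_right_mono power_mono) auto
      have "0 \<le> (cmod (dft Q ?g j))\<^sup>2 / c\<^sup>2" by simp
      moreover have "(cmod (dft Q f j))\<^sup>2 \<le> 4 * (cmod (dft Q ?h j))\<^sup>2"
        using * by (simp add: power_divide)
      ultimately show ?thesis by linarith
    qed
  qed
  have "real Q * (\<Sum>y\<in>{0..<int Q}. (cmod (f y))\<^sup>2) \<le>
    (\<Sum>j<Q. (cmod (dft Q ?g j))\<^sup>2 / c\<^sup>2 + 4 * (cmod (dft Q ?h j))\<^sup>2)"
    unfolding parseval[OF Q, symmetric] by (intro sum_mono pt) simp
  also have "\<dots> = real Q * ((\<Sum>y\<in>{0..<int Q}. (cmod (?g y))\<^sup>2) / c\<^sup>2
    + 4 * (\<Sum>y\<in>{0..<int Q}. (cmod (?h y))\<^sup>2))"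
    by (simp add: sum.distrib parseval[OF Q] algebra_simps flip: sum_divide_distrib sum_distrib_left)
  finally show ?thesis
    using Q by simp
qed

section \<open>Increasing the density of subset sums\<close>

definition subset_sums :: "nat set \<Rightarrow> nat set" where
  "subset_sums U = {\<Sum>F | F. finite F \<and> F \<subseteq> U}"

lemma subset_sums_iff: "n \<in> subset_sums U \<longleftrightarrow> (\<exists>F. finite F \<and> F \<subseteq> U \<and> n = \<Sum>F)"
  unfolding subset_sums_def by blast

lemma subset_sums_mono: "U \<subseteq> V \<Longrightarrow> subset_sums U \<subseteq> subset_sums V"
  unfolding subset_sums_def by blast

text \<open>
  A windowed form of upper Banach density at least \<open>d\<close>. Every window length must be attained without an
  error term, so a set failing the condition has a length at which all its windows have density below \<open>d\<close>.
\<close>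

definition dense_windows :: "nat set \<Rightarrow> real \<Rightarrow> bool" where
  "dense_windows W d \<longleftrightarrow> (\<forall>X\<ge>1. \<exists>x. d * real X \<le> real (card (W \<inter> {x..<x + X})))"

lemma dense_windows_mono:
  assumes "dense_windows W d" "d' \<le> d"
  shows "dense_windows W d'"
  unfolding dense_windows_def
proof (intro allI impI)
  fix X :: nat assume "X \<ge> 1"
  with assms(1) obtain x where "d * real X \<le> real (card (W \<inter> {x..<x + X}))"
    unfolding dense_windows_def by blast
  moreover have "d' * real X \<le> d * real X"
    using assms(2) by (intro mult_right_mono) auto
  ultimately show "\<exists>x. d' * real X \<le> real (card (W \<inter> {x..<x + X}))"
    by (meson order_trans)
qed

lemma card_window_mult:
  assumes "\<And>x. real (card (W \<inter> {x..<x + X})) \<le> b"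
  shows "real (card (W \<inter> {x..<x + X * M})) \<le> b * real M"
proof (induction M)
  case (Suc M)
  have "W \<inter> {x..<x + X * Suc M} = (W \<inter> {x..<x + X * M}) \<union> (W \<inter> {x + X * M..<x + X * M + X})"
    by auto
  then have "card (W \<inter> {x..<x + X * Suc M}) \<le>
      card (W \<inter> {x..<x + X * M}) + card (W \<inter> {x + X * M..<x + X * M + X})"
    by (simp add: card_Un_le)
  with Suc assms[of "x + X * M"] show ?case
    by (simp add: algebra_simps)
qed simp

text \<open>
  In a sum that vanishes, the positive and the negative parts have the same size, so one-sided bounds
  control the absolute values. This turns upper bounds for densities into \<open>L\<^sup>1\<close> bounds.
\<close>

lemma sum_abs_le_twice_upper:
  fixes a b :: "'i \<Rightarrow> real"
  assumes "(\<Sum>y\<in>Y. a y) = 0" "\<And>y. y \<in> Y \<Longrightarrow> a y \<le> b y" "\<And>y. y \<in> Y \<Longrightarrow> 0 \<le> b y"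
  shows "(\<Sum>y\<in>Y. \<bar>a y\<bar>) \<le> 2 * (\<Sum>y\<in>Y. b y)"
proof -
  have "(\<Sum>y\<in>Y. \<bar>a y\<bar>) \<le> (\<Sum>y\<in>Y. 2 * b y - a y)"
    using assms(2,3) by (intro sum_mono) (force simp: abs_if)
  then show ?thesis
    using assms(1) by (simp add: sum_subtractf sum_distrib_left)
qed

lemma mean_square_le_mean_abs:
  fixes a :: "'i \<Rightarrow> real"
  assumes "finite I" "I \<noteq> {}" "\<And>i. i \<in> I \<Longrightarrow> \<bar>a i\<bar> \<le> 1"
  shows "((\<Sum>i\<in>I. a i) / card I)\<^sup>2 \<le> (\<Sum>i\<in>I. \<bar>a i\<bar>) / card I"
proof -
  let ?A = "(\<Sum>i\<in>I. \<bar>a i\<bar>) / card I"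
  have "(\<Sum>i\<in>I. \<bar>a i\<bar>) \<le> card I"
    using sum_mono[of I "\<lambda>i. \<bar>a i\<bar>" "\<lambda>_. 1"] assms(3) by simp
  then have "?A \<le> 1" "0 \<le> ?A"
    using assms(1,2) by (simp_all add: divide_le_eq_1 sum_nonneg card_gt_0_iff)
  have "\<bar>(\<Sum>i\<in>I. a i) / card I\<bar> \<le> ?A"
    by (simp add: divide_right_mono)
  then have "((\<Sum>i\<in>I. a i) / card I)\<^sup>2 \<le> ?A\<^sup>2"
    by (metis power2_abs power_mono abs_ge_zero)
  also have "\<dots> \<le> ?A"
    unfolding power2_eq_square by (rule mult_left_le) fact+
  finally show ?thesis .
qed

text \<open>
  Averaging over all subset sums of independent generators factorises, one factor for each generator.
\<close>

lemma mean_character_subset_sums: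
  assumes "finite I"
  shows "mean_character (Pow I) (\<lambda>R. int (\<Sum>i\<in>R. g i)) \<theta>
    = (\<Prod>i\<in>I. (1 + cis (- (2 * pi * \<theta> * real (g i)))) / 2)"
proof -
  have "(\<Prod>i\<in>I. cis (- (2 * pi * \<theta> * real (g i))) + 1) =
      (\<Sum>R\<in>Pow I. (\<Prod>i\<in>R. cis (- (2 * pi * \<theta> * real (g i)))) * (\<Prod>i\<in>I - R. 1))"
    by (rule prod_add[OF assms])
  also have "\<dots> = (\<Sum>R\<in>Pow I. cis (- (2 * pi * \<theta> * real_of_int (int (\<Sum>i\<in>R. g i)))))"
  proof (rule sum.cong[OF refl])
    fix R assume "R \<in> Pow I"
    then have "finite R" using assms finite_subset by auto
    then have "(\<Prod>i\<in>R. cis (- (2 * pi * \<theta> * real (g i)))) = cis (- (2 * pi * \<theta> * real (\<Sum>i\<in>R. g i)))"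
      by (induction R) (auto simp: cis_mult algebra_simps)
    then show "(\<Prod>i\<in>R. cis (- (2 * pi * \<theta> * real (g i)))) * (\<Prod>i\<in>I - R. 1)
      = cis (- (2 * pi * \<theta> * real_of_int (int (\<Sum>i\<in>R. g i))))"
      by simp
  qed
  finally show ?thesis
    using assms by (simp add: mean_character_def prod_dividef card_Pow add.commute)
qed

text \<open>
  In the factorisation all factors have absolute value at most \<open>1\<close>, so a single generator \<open>g i\<close> with \<open>g i * \<theta>\<close>
  away from the integers keeps the whole product away from \<open>1\<close>. Different frequencies may rely on different
  generators, so one average over subset sums serves all of them at the same time.
\<close>

lemma mean_character_far_from_1:
  assumes "finite I" "0 \<le> e" "i \<in> I" "e \<le> dist_nearest_int (real (g i) * \<theta>)"
  shows "1 - cos (pi * e) \<le> cmod (1 - mean_character (Pow I) (\<lambda>R. int (\<Sum>i\<in>R. g i)) \<theta>)"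
proof -
  have fac: "cmod ((1 + cis (- (2 * pi * \<theta> * real (g i)))) / 2) = \<bar>cos (pi * (real (g i) * \<theta>))\<bar>" for i
    using norm_one_plus_cis[of "- (pi * (real (g i) * \<theta>))"] by (simp add: norm_divide mult_ac)
  have "cmod (mean_character (Pow I) (\<lambda>R. int (\<Sum>i\<in>R. g i)) \<theta>)
      = (\<Prod>i\<in>I. \<bar>cos (pi * (real (g i) * \<theta>))\<bar>)"
    unfolding mean_character_subset_sums[OF assms(1)] prod_norm[symmetric] fac ..
  also have "\<dots> = \<bar>cos (pi * (real (g i) * \<theta>))\<bar> * (\<Prod>i\<in>I - {i}. \<bar>cos (pi * (real (g i) * \<theta>))\<bar>)"
    using assms by (simp add: prod.remove)
  also have "\<dots> \<le> \<bar>cos (pi * (real (g i) * \<theta>))\<bar> * 1"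
    by (intro mult_left_mono prod_le_1) auto
  also have "\<dots> \<le> cos (pi * e)"
    using abs_cos_le_of_dist_nearest_int[OF assms(2,4)] by simp
  finally show ?thesis
    using norm_triangle_ineq2[of 1 "mean_character (Pow I) (\<lambda>R. int (\<Sum>i\<in>R. g i)) \<theta>"] by simp
qed

text \<open>
  A window of length \<open>X\<close> is too short to notice oscillation at frequencies below \<open>1 / (16 * X)\<close>: all phases stay
  within \<open>2 * pi / 16 < 1 / 2\<close> of \<open>0\<close>.
\<close>

lemma mean_character_low_frequency:
  assumes "X \<ge> 1" "N \<ge> 16 * X" "0 \<le> \<theta>" "\<theta> \<le> 1" "\<theta> < 1 / real N \<or> 1 - 1 / real N < \<theta>"
  shows "1 / 2 \<le> cmod (mean_character {..<X} int \<theta>)"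
proof -
  obtain \<phi> where phi: "\<bar>\<phi>\<bar> \<le> 1 / real N"
    and cis: "\<And>i::nat. cis (- (2 * pi * \<theta> * real i)) = cis (- (2 * pi * \<phi> * real i))"
  proof (cases "\<theta> < 1 / real N")
    case True
    then show ?thesis using assms(3) that[of \<theta>] by simp
  next
    case False
    have "cis (- (2 * pi * \<theta> * real i)) = cis (- (2 * pi * (\<theta> - 1) * real i))" for i
    proof -
      have "cis (- (2 * pi * (\<theta> - 1) * real i)) = cis (- (2 * pi * \<theta> * real i)) * cis (2 * pi * real i)"
        unfolding cis_mult by (rule arg_cong[where f = cis]) (simp add: algebra_simps)
      then show ?thesis using cis_multiple_2pi[of "real i"] by simp
    qed
    then show ?thesis using False assms that[of "\<theta> - 1"] by simp
  qed
  have "cmod (1 - cis (- (2 * pi * \<phi> * real i))) \<le> 1 / 2" if "i < X" for i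
  proof -
    have "cmod (1 - cis (- (2 * pi * \<phi> * real i))) \<le> 2 * pi * (\<bar>\<phi>\<bar> * real i)"
      using norm_one_minus_cis_le[of "- (2 * pi * \<phi> * real i)"] by (simp add: abs_mult mult_ac)
    also have "\<bar>\<phi>\<bar> * real i \<le> 1 / real N * real X"
      using phi that by (intro mult_mono) auto
    also have "\<dots> \<le> 1 / 16"
      using assms(1,2) by (simp add: field_simps)
    also have "2 * pi * (1 / 16) \<le> 1 / 2"
      using pi_less_4 by simp
    finally show ?thesis by simp
  qed
  then have "cmod (\<Sum>i<X. 1 - cis (- (2 * pi * \<phi> * real i))) \<le> (\<Sum>i<X. 1 / 2)"
    by (intro sum_norm_le) auto
  then have "cmod ((\<Sum>i<X. 1 - cis (- (2 * pi * \<phi> * real i))) / of_nat X) \<le> 1 / 2"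
    using assms(1) by (simp add: norm_divide field_simps)
  moreover have "(\<Sum>i<X. 1 - cis (- (2 * pi * \<phi> * real i))) / of_nat X = 1 - mean_character {..<X} int \<theta>"
    using assms(1) by (simp add: mean_character_def cis sum_subtractf diff_divide_distrib)
  ultimately have "cmod (1 - mean_character {..<X} int \<theta>) \<le> 1 / 2" by simp
  then show ?thesis
    using norm_triangle_ineq2[of 1 "mean_character {..<X} int \<theta>"] by simp
qed


text \<open>
  The density increment argument in quantitative form. The indicator function \<open>f\<close> of \<open>W\<close>, on a window where
  the density \<open>m\<close> of \<open>W\<close> is almost maximal, is almost invariant under translation by the subset sums of
  \<open>g\<close>, because \<open>W'\<close> contains \<open>W\<close> together with these translates and is hardly denser than \<open>W\<close>. Its averages over
  intervals of length \<open>X\<close> are almost constant, because none of them exceeds the mean by much. The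
  variance of \<open>f\<close> is \<open>m * (1 - m)\<close>, and \<open>norm_bound_by_translates\<close> bounds it by the two deviations.
\<close>

lemma density_variance_bound:
  fixes W W' :: "nat set" and g :: "'i \<Rightarrow> nat"
  assumes fin: "finite I" and shifts: "\<And>w R. w \<in> W \<Longrightarrow> R \<subseteq> I \<Longrightarrow> w + (\<Sum>i\<in>R. g i) \<in> W'"
    and lower: "dense_windows W (\<delta> - \<eta>)"
    and upper: "X \<ge> 1" "\<And>x. real (card (W \<inter> {x..<x + X})) \<le> (\<delta> + \<eta>) * real X"
    and upper': "X' \<ge> 1" "\<And>x. real (card (W' \<inter> {x..<x + X'})) \<le> (\<delta> + \<eta>) * real X'"
    and eta: "\<eta> > 0" and N: "N \<ge> 16 * X" and e: "0 < e" "e \<le> 1 / 2"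
    and det: "\<And>\<theta>. 1 / real N \<le> \<theta> \<Longrightarrow> \<theta> \<le> 1 - 1 / real N
      \<Longrightarrow> \<exists>i\<in>I. e \<le> dist_nearest_int (real (g i) * \<theta>)"
  shows "\<exists>m. \<delta> - \<eta> \<le> m \<and> m \<le> \<delta> + \<eta> \<and> m * (1 - m) \<le> \<eta> * (6 / (1 - cos (pi * e))\<^sup>2 + 24)"
proof -
  define G where "G = (\<Sum>i\<in>I. g i)"
  define M where "M = nat \<lceil>real (G + X) / \<eta>\<rceil> + 1"
  \<comment> \<open>The window is a multiple of the length at which the density of \<open>W'\<close> is bounded,
      and so long that wrapping around it cyclically costs only \<open>\<eta> * Q\<close> points.\<close>
  define Q where "Q = X' * M"
  have "real (G + X) / \<eta> \<le> real M" unfolding M_def by linarith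
  also have "\<dots> \<le> real Q" using upper'(1) by (cases X') (simp_all add: Q_def)
  finally have GX: "real G + real X \<le> \<eta> * real Q"
    using eta by (simp add: field_simps)
  have Q: "Q > 0" using upper'(1) by (simp add: Q_def M_def)
  let ?Y = "{0..<int Q}"
  obtain x where x: "(\<delta> - \<eta>) * real Q \<le> real (card (W \<inter> {x..<x + Q}))"
    using lower Q unfolding dense_windows_def by (metis Suc_leI One_nat_def)
  have x': "real (card (W' \<inter> {x..<x + Q})) \<le> (\<delta> + \<eta>) * real Q"
    using card_window_mult[OF upper'(2), of x M] by (simp add: Q_def)
  define f :: "int \<Rightarrow> real" where "f y = of_bool (x + nat (y mod int Q) \<in> W)" for y
  define f' :: "int \<Rightarrow> real" where "f' y = of_bool (x + nat y \<in> W')" for y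
  have f01: "0 \<le> f y" "f y \<le> 1" "f y = 0 \<or> f y = 1" for y
    by (simp_all add: f_def)
  have per: "periodic Q f"
    by (simp add: periodic_def f_def)
  have f_Y: "f y = of_bool (x + nat y \<in> W)" if "y \<in> ?Y" for y
    using that by (simp add: f_def)
  have count: "(\<Sum>y\<in>{int a..<int b}. of_bool (x + nat y \<in> V)) = real (card (V \<inter> {x + a..<x + b}))"
    for V a b
  proof -
    have "(\<Sum>y\<in>{int a..<int b}. of_bool (x + nat y \<in> V)) = (\<Sum>z\<in>{x + a..<x + b}. of_bool (z \<in> V) :: real)"
      by (rule sum.reindex_bij_witness[where i = "\<lambda>z. int z - int x" and j = "\<lambda>y. x + nat y"]) auto
    then show ?thesis
      by (simp add: Int_commute)
  qed
  have sum_f: "(\<Sum>y\<in>?Y. f y) = real (card (W \<inter> {x..<x + Q}))"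
    using count[of W 0 Q] by (simp add: f_Y)
  have sum_f': "(\<Sum>y\<in>?Y. f' y) = real (card (W' \<inter> {x..<x + Q}))"
    using count[of W' 0 Q] by (simp add: f'_def)
  have W_W': "W \<subseteq> W'" using shifts[of _ "{}"] by auto
  have f_f': "f y \<le> f' y" if "y \<in> ?Y" for y
    using W_W' by (auto simp: f_Y[OF that] f'_def)
  define m where "m = (\<Sum>y\<in>?Y. f y) / real Q"
  have mQ: "(\<Sum>y\<in>?Y. f y) = m * real Q"
    using Q by (simp add: m_def)
  have m_low: "\<delta> - \<eta> \<le> m"
    using x Q by (simp add: m_def sum_f field_simps)
  have "(\<Sum>y\<in>?Y. f y) \<le> (\<Sum>y\<in>?Y. f' y)"
    by (intro sum_mono f_f')
  then have m_high: "m \<le> \<delta> + \<eta>"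
    using x' Q by (simp add: m_def sum_f sum_f' field_simps)
  have m01: "0 \<le> m" "m \<le> 1"
    using sum_mono[of ?Y f "\<lambda>_. 1"] Q by (auto simp: m_def f01 sum_nonneg divide_le_eq_1)
  have shift_sum: "(\<Sum>y\<in>?Y. f (y - t)) = (\<Sum>y\<in>?Y. f y)" for t
    by (rule sum_period_shift[OF Q per])

  have shift_close: "(\<Sum>y\<in>?Y. \<bar>f y - f (y - int t)\<bar>) \<le> 6 * \<eta> * real Q"
    if R: "R \<subseteq> I" and t: "t = (\<Sum>i\<in>R. g i)" for R t
  proof -
    have "t \<le> G" unfolding t G_def by (rule sum_mono2) (use fin R in auto)
    \<comment> \<open>A point of the translate that is not in \<open>W\<close> either comes from the wrap-around or lies
        in the surplus of \<open>W'\<close> over \<open>W\<close>.\<close>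
    have "(\<Sum>y\<in>?Y. \<bar>f (y - int t) - f y\<bar>) \<le> 2 * (\<Sum>y\<in>?Y. of_bool (y < int t) + (f' y - f y))"
    proof (rule sum_abs_le_twice_upper)
      show "(\<Sum>y\<in>?Y. f (y - int t) - f y) = 0"
        by (simp add: sum_subtractf shift_sum)
    next
      fix y assume y: "y \<in> ?Y"
      then show "0 \<le> of_bool (y < int t) + (f' y - f y)"
        using f_f' by fastforce
      show "f (y - int t) - f y \<le> of_bool (y < int t) + (f' y - f y)"
      proof (cases "y < int t")
        case True
        then show ?thesis using f01(2)[of "y - int t"] f_f'[OF y] f01(1)[of y] by simp
      next
        case False
        have "x + nat y \<in> W'" if "x + nat (y - int t) \<in> W"
          using shifts[OF that R] False by (simp add: t[symmetric] nat_diff_distrib')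
        then show ?thesis
          using False y f01 by (auto simp: f_def f'_def)
      qed
    qed
    also have "(\<Sum>y\<in>?Y. of_bool (y < int t) + (f' y - f y)) =
        (\<Sum>y\<in>?Y. of_bool (y < int t)) + ((\<Sum>y\<in>?Y. f' y) - (\<Sum>y\<in>?Y. f y))"
      by (simp add: sum.distrib sum_subtractf)
    also have "(\<Sum>y\<in>?Y. of_bool (y < int t) :: real) = real (card (?Y \<inter> {y. y < int t}))"
      by simp
    also have "card (?Y \<inter> {y. y < int t}) \<le> card {0..<int t}"
      by (intro card_mono) auto
    also have "real (card {0..<int t}) \<le> real G"
      using \<open>t \<le> G\<close> by simp
    finally show ?thesis
      using x x' GX by (simp add: sum_f sum_f' abs_minus_commute algebra_simps)
  qed

  define u :: "int \<Rightarrow> complex" where "u y = of_real (f y - m)" for y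
  have per_u: "periodic Q u"
    using per by (simp add: periodic_def u_def)
  let ?s = "\<lambda>R. int (\<Sum>i\<in>R. g i)"
  let ?c = "1 - cos (pi * e)"
  have c_pos: "?c > 0"
    using e cos_monotone_0_pi[of 0 "pi * e"] pi_gt_zero by (simp add: field_simps)
  have main: "(\<Sum>y\<in>?Y. (cmod (u y))\<^sup>2) \<le>
    (\<Sum>y\<in>?Y. (cmod (u y - mean_translate (Pow I) ?s u y))\<^sup>2) / ?c\<^sup>2
    + 4 * (\<Sum>y\<in>?Y. (cmod (mean_translate {..<X} int u y))\<^sup>2)"
  proof (rule norm_bound_by_translates[OF Q per_u _ c_pos])
    have "(\<Sum>y\<in>?Y. u y) = of_real ((\<Sum>y\<in>?Y. f y) - m * real Q)"
      by (simp add: u_def sum_subtractf)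
    then show "(\<Sum>y\<in>?Y. u y) = 0" by (simp add: mQ)
  next
    fix j assume j: "0 < j" "j < Q"
    let ?th = "real j / real Q"
    show "?c \<le> cmod (1 - mean_character (Pow I) ?s ?th) \<or> 1 / 2 \<le> cmod (mean_character {..<X} int ?th)"
    proof (cases "1 / real N \<le> ?th \<and> ?th \<le> 1 - 1 / real N")
      case True
      with det obtain i where "i \<in> I" "e \<le> dist_nearest_int (real (g i) * ?th)" by blast
      then show ?thesis
        using mean_character_far_from_1[OF fin, of e i g ?th] e by simp
    next
      case False
      then show ?thesis
        using mean_character_low_frequency[OF upper(1) N, of ?th] j by auto
    qed
  qed
  have "(\<Sum>y\<in>?Y. (cmod (u y - mean_translate (Pow I) ?s u y))\<^sup>2) \<le> 6 * \<eta> * real Q"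
  proof -
    let ?n = "real (card (Pow I))"
    have n: "?n > 0" using fin by (simp add: card_Pow)
    have "(cmod (u y - mean_translate (Pow I) ?s u y))\<^sup>2 \<le> (\<Sum>R\<in>Pow I. \<bar>f y - f (y - ?s R)\<bar>) / ?n" for y
    proof -
      have "u y - mean_translate (Pow I) ?s u y = (\<Sum>R\<in>Pow I. u y - u (y - ?s R)) / of_real ?n"
        using n by (simp add: mean_translate_def sum_subtractf diff_divide_distrib)
      also have "\<dots> = of_real ((\<Sum>R\<in>Pow I. f y - f (y - ?s R)) / ?n)"
        by (simp add: u_def)
      finally have "(cmod (u y - mean_translate (Pow I) ?s u y))\<^sup>2 = ((\<Sum>R\<in>Pow I. f y - f (y - ?s R)) / ?n)\<^sup>2"
        by (simp only: norm_of_real power2_abs)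
      also have "\<dots> \<le> (\<Sum>R\<in>Pow I. \<bar>f y - f (y - ?s R)\<bar>) / ?n"
      proof (rule mean_square_le_mean_abs)
        show "\<bar>f y - f (y - ?s R)\<bar> \<le> 1" for R
          using f01[of y] f01[of "y - ?s R"] by linarith
      qed (use fin in auto)
      finally show ?thesis .
    qed
    then have "(\<Sum>y\<in>?Y. (cmod (u y - mean_translate (Pow I) ?s u y))\<^sup>2)
        \<le> (\<Sum>y\<in>?Y. (\<Sum>R\<in>Pow I. \<bar>f y - f (y - ?s R)\<bar>) / ?n)"
      by (rule sum_mono)
    also have "\<dots> = (\<Sum>R\<in>Pow I. \<Sum>y\<in>?Y. \<bar>f y - f (y - ?s R)\<bar>) / ?n"
      by (subst sum.swap) (simp add: sum_divide_distrib)
    also have "\<dots> \<le> (\<Sum>R\<in>Pow I. 6 * \<eta> * real Q) / ?n"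
      by (intro divide_right_mono sum_mono shift_close) auto
    also have "\<dots> = 6 * \<eta> * real Q"
      using n by simp
    finally show ?thesis .
  qed
  moreover have "(\<Sum>y\<in>?Y. (cmod (mean_translate {..<X} int u y))\<^sup>2) \<le> 6 * \<eta> * real Q"
  proof -
    define a where "a y = (\<Sum>i<X. f (y - int i)) / real X - m" for y
    have mt: "cmod (mean_translate {..<X} int u y) = \<bar>a y\<bar>" for y
    proof -
      have "mean_translate {..<X} int u y = of_real ((\<Sum>i<X. f (y - int i) - m) / real X)"
        by (simp add: mean_translate_def u_def)
      also have "(\<Sum>i<X. f (y - int i) - m) / real X = a y"
        using upper(1) by (simp add: a_def sum_subtractf diff_divide_distrib)
      finally show ?thesis by (simp only: norm_of_real)
    qed
    have avg: "0 \<le> (\<Sum>i<X. f (y - int i)) / real X" "(\<Sum>i<X. f (y - int i)) / real X \<le> 1" for y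
      using sum_mono[of "{..<X}" "\<lambda>i. f (y - int i)" "\<lambda>_. 1"] upper(1)
      by (auto simp: f01 sum_nonneg divide_le_eq_1)
    then have a1: "\<bar>a y\<bar> \<le> 1" for y
      using m01 avg[of y] unfolding a_def by linarith
    \<comment> \<open>The squares may be replaced by absolute values, which only need an upper bound for the averages.\<close>
    have "(\<Sum>y\<in>?Y. (cmod (mean_translate {..<X} int u y))\<^sup>2) \<le> (\<Sum>y\<in>?Y. \<bar>a y\<bar>)"
      unfolding mt by (intro sum_mono) (use a1 in \<open>simp add: power2_eq_square mult_left_le del: abs_mult_self_eq\<close>)
    also have "\<dots> \<le> 2 * (\<Sum>y\<in>?Y. of_bool (y < int X) + 2 * \<eta>)"
    proof (rule sum_abs_le_twice_upper)
      have "(\<Sum>y\<in>?Y. a y) = (\<Sum>i<X. \<Sum>y\<in>?Y. f (y - int i)) / real X - m * real Q"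
        unfolding a_def by (subst sum.swap) (simp add: sum_subtractf sum_divide_distrib)
      then show "(\<Sum>y\<in>?Y. a y) = 0"
        using upper(1) by (simp add: shift_sum mQ)
    next
      fix y assume y: "y \<in> ?Y"
      show "0 \<le> of_bool (y < int X) + 2 * \<eta>" using eta by simp
      show "a y \<le> of_bool (y < int X) + 2 * \<eta>"
      proof (cases "y < int X")
        case True
        then show ?thesis using a1[of y] eta by simp
      next
        case False
        define b where "b = nat y + 1"
        have b: "y = int b - 1" "X \<le> b" "b \<le> Q" using y False by (auto simp: b_def)
        have "(\<Sum>i<X. f (y - int i)) = (\<Sum>z\<in>{int (b - X)..<int b}. f z)"
          by (rule sum.reindex_bij_witness[where i = "\<lambda>z. nat (y - z)" and j = "\<lambda>i. y - int i"])
             (use b in auto)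
        also have "\<dots> = (\<Sum>z\<in>{int (b - X)..<int b}. of_bool (x + nat z \<in> W))"
          by (intro sum.cong refl f_Y) (use b in auto)
        also have "\<dots> = real (card (W \<inter> {x + (b - X)..<x + (b - X) + X}))"
          using count[of W "b - X" b] b by simp
        also have "\<dots> \<le> (\<delta> + \<eta>) * real X" by (rule upper(2))
        finally have "(\<Sum>i<X. f (y - int i)) / real X \<le> \<delta> + \<eta>"
          using upper(1) by (simp add: field_simps)
        then show ?thesis
          using m_low False by (simp add: a_def)
      qed
    qed
    also have "(\<Sum>y\<in>?Y. of_bool (y < int X) + 2 * \<eta>) = real (card (?Y \<inter> {y. y < int X})) + 2 * \<eta> * real Q"
      by (simp add: sum.distrib)
    also have "card (?Y \<inter> {y. y < int X}) \<le> card {0..<int X}"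
      by (intro card_mono) auto
    also have "2 * (real (card {0..<int X}) + 2 * \<eta> * real Q) \<le> 6 * \<eta> * real Q"
      using GX by simp
    finally show ?thesis by simp
  qed
  moreover have "(\<Sum>y\<in>?Y. (cmod (u y))\<^sup>2) = m * (1 - m) * real Q"
  proof -
    have sq: "(cmod (u y))\<^sup>2 = (1 - 2 * m) * f y + m\<^sup>2" for y
    proof -
      have "(cmod (u y))\<^sup>2 = (f y - m)\<^sup>2" by (simp only: u_def norm_of_real power2_abs)
      then show ?thesis using f01(3)[of y] by (auto simp: power2_eq_square algebra_simps)
    qed
    have "(\<Sum>y\<in>?Y. (cmod (u y))\<^sup>2) = (1 - 2 * m) * (m * real Q) + m\<^sup>2 * real Q"
      unfolding sq by (simp add: sum.distrib mQ flip: sum_distrib_left)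
    then show ?thesis by (simp add: power2_eq_square algebra_simps)
  qed
  ultimately have "m * (1 - m) * real Q \<le> 6 * \<eta> * real Q / ?c\<^sup>2 + 4 * (6 * \<eta> * real Q)"
    using main by (smt (verit) divide_right_mono zero_le_power2)
  also have "\<dots> = \<eta> * (6 / ?c\<^sup>2 + 24) * real Q"
    by (simp add: algebra_simps)
  finally have "m * (1 - m) \<le> \<eta> * (6 / ?c\<^sup>2 + 24)"
    using Q by simp
  with m_low m_high show ?thesis by blast
qed


text \<open>
  Let \<open>\<delta>\<close> be the supremum of the attainable densities. If \<open>0 < \<delta> < 1\<close>, then some \<open>V\<close> attains \<open>\<delta> - \<eta>\<close>, while neither
  \<open>V\<close> nor any larger finite subset of \<open>U\<close> attains \<open>\<delta> + \<eta>\<close>. Enlarging \<open>V\<close> by a family that detects all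
  frequencies except those near \<open>0\<close>, the variance bound forces \<open>\<delta> * (1 - \<delta>)\<close> to be of the order of
  \<open>\<eta>\<close>, which is impossible for small \<open>\<eta>\<close>.
\<close>

theorem subset_sums_density_saturates:
  assumes disj: "E \<inter> U = {}"
    and base: "dense_windows (subset_sums E) d0" "d0 > 0"
    and e: "0 < e" "e \<le> 1 / 2"
    and det: "\<And>N. N \<ge> 1 \<Longrightarrow> \<exists>\<P>. finite \<P> \<and> disjoint \<P> \<and> (\<forall>P\<in>\<P>. finite P \<and> P \<subseteq> U \<inter> {N<..}) \<and>
      (\<forall>\<theta>. 1 / real N \<le> \<theta> \<and> \<theta> \<le> 1 - 1 / real N \<longrightarrow> (\<exists>P\<in>\<P>. e \<le> dist_nearest_int (real (\<Sum>P) * \<theta>)))"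
    and d: "d < 1"
  shows "\<exists>V. finite V \<and> V \<subseteq> U \<and> dense_windows (subset_sums (E \<union> V)) d"
proof (rule ccontr)
  assume neg: "\<not> ?thesis"
  define S where "S = {d. \<exists>V. finite V \<and> V \<subseteq> U \<and> dense_windows (subset_sums (E \<union> V)) d}"
  define \<delta> where "\<delta> = Sup S"
  have S_le: "d' \<le> d" if "d' \<in> S" for d'
    using that neg dense_windows_mono[of _ d' d] unfolding S_def by force
  then have bdd: "bdd_above S" by (meson bdd_above.I)
  have "d0 \<in> S" using base(1) unfolding S_def by (auto intro!: exI[of _ "{}"])
  then have \<delta>_pos: "\<delta> > 0" and ne: "S \<noteq> {}"
    using base(2) cSup_upper[OF _ bdd] unfolding \<delta>_def by force+
  have \<delta>_less: "\<delta> < 1"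
    using cSup_least[OF ne S_le] d unfolding \<delta>_def by fastforce
  define K where "K = 6 / (1 - cos (pi * e))\<^sup>2 + 24"
  have K: "K > 0" unfolding K_def by (intro add_nonneg_pos) auto
  define \<eta> where "\<eta> = min (min (\<delta> / 2) ((1 - \<delta>) / 2)) (\<delta> * (1 - \<delta>) / (8 * K))"
  have eta: "\<eta> > 0" "\<eta> \<le> \<delta> / 2" "\<eta> \<le> (1 - \<delta>) / 2" "\<eta> \<le> \<delta> * (1 - \<delta>) / (8 * K)"
    using \<delta>_pos \<delta>_less K unfolding \<eta>_def by (simp, linarith, linarith, linarith)
  have dp: "0 < \<delta> * (1 - \<delta>)" using \<delta>_pos \<delta>_less by simp
  have not_dense: "\<exists>X\<ge>1. \<forall>x. real (card (subset_sums (E \<union> V) \<inter> {x..<x + X})) \<le> (\<delta> + \<eta>) * real X"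
    if "finite V" "V \<subseteq> U" for V
  proof -
    have "\<delta> + \<eta> \<notin> S"
      using cSup_upper[OF _ bdd, of "\<delta> + \<eta>"] eta(1) unfolding \<delta>_def[symmetric] by auto
    then have "\<not> dense_windows (subset_sums (E \<union> V)) (\<delta> + \<eta>)"
      using that unfolding S_def by blast
    then obtain X where "X \<ge> 1"
      "\<And>x. \<not> (\<delta> + \<eta>) * real X \<le> real (card (subset_sums (E \<union> V) \<inter> {x..<x + X}))"
      unfolding dense_windows_def by blast
    then show ?thesis
      by (intro exI[of _ X] conjI allI) (simp_all add: not_le less_imp_le)
  qed
  obtain d1 where "d1 \<in> S" "\<delta> - \<eta> < d1"
    using less_cSupD[OF ne, of "\<delta> - \<eta>"] eta(1) unfolding \<delta>_def[symmetric] by auto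
  then obtain V where V: "finite V" "V \<subseteq> U" "dense_windows (subset_sums (E \<union> V)) (\<delta> - \<eta>)"
    unfolding S_def using dense_windows_mono[of _ d1 "\<delta> - \<eta>"] by force
  obtain X where X: "X \<ge> 1" "\<And>x. real (card (subset_sums (E \<union> V) \<inter> {x..<x + X})) \<le> (\<delta> + \<eta>) * real X"
    using not_dense[OF V(1,2)] by blast
  \<comment> \<open>The summand \<open>16 * X\<close> covers the low frequencies,
      the summand \<open>\<Sum>V\<close> keeps the new elements disjoint from \<open>V\<close>.\<close>
  define N where "N = 16 * X + \<Sum>V"
  have N: "N \<ge> 16 * X" "N \<ge> 1" using X(1) by (auto simp: N_def)
  have V_le: "v \<le> N" if "v \<in> V" for v
    using member_le_sum[OF that, of "\<lambda>v. v"] V(1) by (simp add: N_def)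
  obtain \<P> where P: "finite \<P>" "disjoint \<P>" "\<forall>P\<in>\<P>. finite P \<and> P \<subseteq> U \<inter> {N<..}"
    and P_det: "\<And>\<theta>. 1 / real N \<le> \<theta> \<Longrightarrow> \<theta> \<le> 1 - 1 / real N
      \<Longrightarrow> \<exists>P\<in>\<P>. e \<le> dist_nearest_int (real (\<Sum>P) * \<theta>)"
    using det[OF N(2)] by metis
  define V' where "V' = V \<union> \<Union>\<P>"
  have V': "finite V'" "V' \<subseteq> U" using V P unfolding V'_def by auto
  obtain X' where X': "X' \<ge> 1" "\<And>x. real (card (subset_sums (E \<union> V') \<inter> {x..<x + X'})) \<le> (\<delta> + \<eta>) * real X'"
    using not_dense[OF V'] by blast
  have shift: "w + (\<Sum>P\<in>\<R>. \<Sum>P) \<in> subset_sums (E \<union> V')"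
    if w: "w \<in> subset_sums (E \<union> V)" and R: "\<R> \<subseteq> \<P>" for w \<R>
  proof -
    obtain F where F: "finite F" "F \<subseteq> E \<union> V" "w = \<Sum>F"
      using w unfolding subset_sums_def by blast
    have "\<forall>P\<in>\<R>. finite P" "\<forall>P\<in>\<R>. \<forall>P'\<in>\<R>. P \<noteq> P' \<longrightarrow> P \<inter> P' = {}"
      using P(2,3) R unfolding disjoint_def by blast+
    from sum.Union_disjoint[OF this, of "\<lambda>y. y"]
    have "\<Sum>(\<Union>\<R>) = (\<Sum>P\<in>\<R>. \<Sum>P)" by simp
    moreover have "F \<inter> \<Union>\<R> = {}"
    proof -
      have "y \<notin> E" "y \<notin> V" if "y \<in> \<Union>\<R>" for y
      proof -
        from that obtain P' where "P' \<in> \<P>" "y \<in> P'" using R by auto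
        then have "y \<in> U" "y > N" using P(3) by auto
        then show "y \<notin> E" "y \<notin> V" using disj V_le by (auto simp: not_le[symmetric])
      qed
      then show ?thesis using F(2) by blast
    qed
    moreover have "finite (\<Union>\<R>)" using P(1,3) R by (meson finite_Union finite_subset subsetD)
    ultimately have "w + (\<Sum>P\<in>\<R>. \<Sum>P) = \<Sum>(F \<union> \<Union>\<R>)"
      using F by (simp add: sum.union_disjoint)
    moreover have "F \<union> \<Union>\<R> \<subseteq> E \<union> V'" using F(2) R by (auto simp: V'_def)
    ultimately show ?thesis
      unfolding subset_sums_def using F(1) \<open>finite (\<Union>\<R>)\<close> by blast
  qed
  obtain m where m: "\<delta> - \<eta> \<le> m" "m \<le> \<delta> + \<eta>" "m * (1 - m) \<le> \<eta> * K"
    using density_variance_bound[OF P(1) shift V(3) X X' eta(1) N(1) e P_det] unfolding K_def by blast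
  have "\<delta> / 2 * ((1 - \<delta>) / 2) \<le> m * (1 - m)"
    using m(1,2) eta \<delta>_pos \<delta>_less by (intro mult_mono) auto
  also have "\<dots> \<le> \<delta> * (1 - \<delta>) / (8 * K) * K"
    using m(3) mult_right_mono[OF eta(4), of K] K by linarith
  also have "\<dots> = \<delta> * (1 - \<delta>) / 8" using K by simp
  finally show False using dp by simp
qed

section \<open>Subset sums far from the integers\<close>

text \<open>
  Adding small terms one at a time cannot jump over the interval from \<open>1 / 4\<close> to \<open>1 / 2\<close>.
\<close>

lemma subset_with_moderate_sum:
  fixes s :: "'i \<Rightarrow> real"
  assumes "finite F" "\<And>a. a \<in> F \<Longrightarrow> 0 \<le> s a \<and> s a < 1 / 4" "1 / 4 \<le> sum s F"
  shows "\<exists>P\<subseteq>F. 1 / 4 \<le> sum s P \<and> sum s P < 1 / 2"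
  using assms
proof (induction F rule: finite_induct)
  case (insert a F)
  show ?case
  proof (cases "1 / 4 \<le> sum s F")
    case True
    then obtain P where "P \<subseteq> F" "1 / 4 \<le> sum s P" "sum s P < 1 / 2"
      using insert by auto
    then show ?thesis by blast
  next
    case False
    moreover have "s a < 1 / 4" using insert.prems(1) by simp
    moreover have "sum s (insert a F) = s a + sum s F" using insert.hyps by simp
    ultimately have "sum s (insert a F) < 1 / 2" by linarith
    then show ?thesis using insert.prems(2) by blast
  qed
qed simp

text \<open>
  If no single multiple is far from the integers, the signed distances of one sign already have a
  divergent sum, and they accumulate without cancellation until they reach the interval from \<open>1 / 4\<close> to \<open>1 / 2\<close>.
\<close>

lemma nonsummable_imp_far_subset_sum:
  fixes X :: "nat set"
  assumes "\<not> (\<lambda>a. dist_nearest_int (real a * \<theta>)) summable_on X"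
  shows "\<exists>P. finite P \<and> P \<subseteq> X \<and> 1 / 4 \<le> dist_nearest_int (real (\<Sum>P) * \<theta>)"
proof (cases "\<exists>a\<in>X. 1 / 4 \<le> dist_nearest_int (real a * \<theta>)")
  case True
  then obtain a where "a \<in> X" "1 / 4 \<le> dist_nearest_int (real a * \<theta>)" by blast
  then show ?thesis by (intro exI[of _ "{a}"]) auto
next
  case False
  define s where "s a = real a * \<theta> - of_int (round (real a * \<theta>))" for a :: nat
  have s_abs: "\<bar>s a\<bar> = dist_nearest_int (real a * \<theta>)" for a
    by (simp add: s_def dist_nearest_int_def)
  define X1 X2 where "X1 = {a \<in> X. 0 \<le> s a}" and "X2 = {a \<in> X. s a \<le> 0}"
  have "X = X1 \<union> X2" by (auto simp: X1_def X2_def)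
  then have "\<not> (\<lambda>a. \<bar>s a\<bar>) summable_on X1 \<or> \<not> (\<lambda>a. \<bar>s a\<bar>) summable_on X2"
    using assms summable_on_union[of "\<lambda>a. \<bar>s a\<bar>" X1 X2] unfolding s_abs by auto
  then obtain X' where X': "X' = X1 \<or> X' = X2" "\<not> (\<lambda>a. \<bar>s a\<bar>) summable_on X'"
    by blast
  then have "\<not> bdd_above (sum (\<lambda>a. \<bar>s a\<bar>) ` {F. F \<subseteq> X' \<and> finite F})"
    using nonneg_bdd_above_summable_on[of X' "\<lambda>a. \<bar>s a\<bar>"] by auto
  then obtain F where F: "F \<subseteq> X'" "finite F" "1 / 4 \<le> (\<Sum>a\<in>F. \<bar>s a\<bar>)"
    unfolding bdd_above_def by (auto simp: not_le dest!: spec[of _ "1 / 4"] less_imp_le)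
  have "X' \<subseteq> X" using X'(1) by (auto simp: X1_def X2_def)
  then have "\<bar>s a\<bar> < 1 / 4" if "a \<in> F" for a
    using False F(1) that unfolding s_abs by force
  then obtain P where P: "P \<subseteq> F" "1 / 4 \<le> (\<Sum>a\<in>P. \<bar>s a\<bar>)" "(\<Sum>a\<in>P. \<bar>s a\<bar>) < 1 / 2"
    using subset_with_moderate_sum[OF F(2), of "\<lambda>a. \<bar>s a\<bar>"] F(3) by auto
  have "\<bar>\<Sum>a\<in>P. s a\<bar> = (\<Sum>a\<in>P. \<bar>s a\<bar>)"
  proof (cases "X' = X1")
    case True
    then have "0 \<le> s a" if "a \<in> P" for a using that P(1) F(1) by (auto simp: X1_def)
    then show ?thesis by (simp add: sum_nonneg)
  next
    case False
    then have "s a \<le> 0" if "a \<in> P" for a using that P(1) F(1) X'(1) by (auto simp: X2_def)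
    then have "(\<Sum>a\<in>P. \<bar>s a\<bar>) = - (\<Sum>a\<in>P. s a)"
      by (simp add: sum_negf[symmetric])
    then show ?thesis using P(2) by simp
  qed
  then have S: "1 / 4 \<le> \<bar>\<Sum>a\<in>P. s a\<bar>" "\<bar>\<Sum>a\<in>P. s a\<bar> < 1 / 2" using P by auto
  define n where "n = (\<Sum>a\<in>P. round (real a * \<theta>))"
  have eq: "real (\<Sum>P) * \<theta> = of_int n + (\<Sum>a\<in>P. s a)"
    by (simp add: s_def n_def sum_subtractf sum_distrib_right)
  have "1 / 4 \<le> dist_nearest_int (real (\<Sum>P) * \<theta>)"
  proof (cases "round (real (\<Sum>P) * \<theta>) = n")
    case True
    then have "dist_nearest_int (real (\<Sum>P) * \<theta>) = \<bar>\<Sum>a\<in>P. s a\<bar>"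
      unfolding dist_nearest_int_def True by (simp only: eq add_diff_cancel_left')
    then show ?thesis using S by simp
  next
    case False
    define k where "k = n - round (real (\<Sum>P) * \<theta>)"
    have "1 \<le> \<bar>k\<bar>" using False by (simp add: k_def)
    then have "1 \<le> \<bar>real_of_int k\<bar>" by linarith
    then have "1 / 4 \<le> \<bar>real_of_int k + (\<Sum>a\<in>P. s a)\<bar>" using S by linarith
    moreover have "real (\<Sum>P) * \<theta> - of_int (round (real (\<Sum>P) * \<theta>)) = of_int k + (\<Sum>a\<in>P. s a)"
      using eq by (simp only: k_def of_int_diff)
    ultimately show ?thesis unfolding dist_nearest_int_def by (simp only:)
  qed
  moreover have "finite P" "P \<subseteq> X"
    using P(1) F \<open>X' \<subseteq> X\<close> by (auto intro: finite_subset)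
  ultimately show ?thesis by blast
qed

lemma summable_on_finite_Union:
  fixes f :: "'a \<Rightarrow> real"
  assumes "finite \<A>" "\<And>Z. Z \<in> \<A> \<Longrightarrow> f summable_on Z"
  shows "f summable_on \<Union>\<A>"
  using assms by (induction \<A>) (auto intro: summable_on_union)

section \<open>Sequences of blocks\<close>

text \<open>
  The setting for the choice of a detecting set: a tail of the given sequence of blocks, with divergence
  instead of triviality of \<open>H1\<close>. Divergence is required for all tails since detecting sums are taken
  from arbitrarily late blocks.
\<close>

locale block_sequence =
  fixes D :: "nat \<Rightarrow> nat set" and r :: nat and C :: real
  assumes finite_D: "finite (D k)"
    and pos_D: "0 \<notin> D k"
    and card_D: "r + 1 \<le> card (D k)"
    and ordered: "Max (D k) < Min (D (Suc k))"
    and ratio: "real (Min (D (Suc k))) \<le> C * real (Min (D k))"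
    and divergent: "\<theta> \<notin> \<int> \<Longrightarrow> \<not> (\<lambda>a. dist_nearest_int (real a * \<theta>)) summable_on (\<Union>k\<in>{K..}. D k)"
begin

definition \<alpha> :: "nat \<Rightarrow> nat" where "\<alpha> k = Min (D k)"

lemma D_nonempty: "D k \<noteq> {}"
  using card_D[of k] by auto

lemma \<alpha>_in_D: "\<alpha> k \<in> D k"
  unfolding \<alpha>_def using finite_D D_nonempty by (rule Min_in)

lemma \<alpha>_le: "a \<in> D k \<Longrightarrow> \<alpha> k \<le> a"
  unfolding \<alpha>_def using finite_D by simp

lemma D_less_\<alpha>_Suc: "a \<in> D k \<Longrightarrow> a < \<alpha> (Suc k)"
  unfolding \<alpha>_def using ordered[of k] finite_D Max_ge le_less_trans by blast

lemma \<alpha>_strict_mono: "strict_mono \<alpha>"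
  using D_less_\<alpha>_Suc[OF \<alpha>_in_D] by (simp add: strict_mono_Suc_iff)

lemma \<alpha>_pos: "\<alpha> k > 0"
  using \<alpha>_in_D[of k] pos_D[of k] by (cases "\<alpha> k = 0") auto

lemma index_less_\<alpha>: "k < \<alpha> k"
  using \<alpha>_pos[of 0] \<alpha>_strict_mono
  by (induction k) (auto simp: strict_mono_Suc_iff intro: Suc_leI less_le_trans order.strict_trans1)

lemma index_less: "a \<in> D k \<Longrightarrow> k < a"
  using index_less_\<alpha>[of k] \<alpha>_le[of a k] by simp

lemma D_less:
  assumes "a \<in> D k" "b \<in> D l" "k < l"
  shows "a < b"
proof -
  have "\<alpha> (Suc k) \<le> \<alpha> l"
    using assms(3) \<alpha>_strict_mono by (simp add: strict_mono_less_eq)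
  then show ?thesis
    using D_less_\<alpha>_Suc[OF assms(1)] \<alpha>_le[OF assms(2)] by simp
qed

lemma D_index_unique: "a \<in> D k \<Longrightarrow> a \<in> D l \<Longrightarrow> k = l"
  using D_less[of a k a l] D_less[of a l a k] by (meson less_irrefl linorder_neqE_nat)

lemma D_disjoint: "k \<noteq> l \<Longrightarrow> D k \<inter> D l = {}"
  using D_index_unique by blast

lemma D_disjoint_UN:
  assumes "X \<subseteq> (\<Union>k\<in>I. D k)" "k \<notin> I"
  shows "D k \<inter> X = {}"
proof (rule ccontr)
  assume "D k \<inter> X \<noteq> {}"
  then obtain a l where "a \<in> D k" "a \<in> D l" "l \<in> I" using assms(1) by blast
  then show False using D_index_unique assms(2) by blast
qed

lemma C_gt_1: "C > 1"
proof -
  have "real (\<alpha> 0) < C * real (\<alpha> 0)"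
  proof -
    have "real (\<alpha> 0) < real (\<alpha> (Suc 0))"
      using \<alpha>_strict_mono by (simp only: strict_mono_Suc_iff of_nat_less_iff)
    then show ?thesis using ratio[of 0] unfolding \<alpha>_def by linarith
  qed
  then show ?thesis using \<alpha>_pos[of 0] by simp
qed

text \<open>
  A deviation of \<open>2 * \<epsilon>\<close> grows to at most \<open>1 / 4\<close> when passing over two consecutive ratios of block minima.
\<close>

definition \<epsilon> :: real where "\<epsilon> = 1 / (8 * C\<^sup>2)"

lemma \<epsilon>_bounds: "0 < \<epsilon>" "\<epsilon> \<le> 1 / 8" "C\<^sup>2 * (2 * \<epsilon>) = 1 / 4"
proof -
  have "1 \<le> C\<^sup>2" using C_gt_1 by (simp add: one_le_power)
  then show "0 < \<epsilon>" "\<epsilon> \<le> 1 / 8" "C\<^sup>2 * (2 * \<epsilon>) = 1 / 4"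
    using C_gt_1 by (auto simp: \<epsilon>_def divide_le_eq_1)
qed

subsection \<open>Rigidity\<close>

text \<open>
  The quantity \<open>\<alpha> k * (\<theta> - \<theta>')\<close> is within \<open>2 * \<epsilon>\<close> of an integer at each block outside \<open>M\<close>, and it grows by a factor
  of at most \<open>C\<^sup>2\<close> from one such block to the next since \<open>M\<close> has no two adjacent elements. So it
  can never reach a nonzero integer, and stays within \<open>2 * \<epsilon>\<close> of \<open>0\<close> once it is there.
\<close>

lemma rigidity:
  assumes sparse: "\<And>k. k \<notin> M \<or> Suc k \<notin> M" and K: "K \<notin> M"
    and small: "\<And>k. K \<le> k \<Longrightarrow> k \<le> Y \<Longrightarrow> k \<notin> M \<Longrightarrow>
      dist_nearest_int (real (\<alpha> k) * \<theta>) \<le> \<epsilon> \<and> dist_nearest_int (real (\<alpha> k) * \<theta>') \<le> \<epsilon>"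
    and start: "\<bar>real (\<alpha> K) * (\<theta> - \<theta>')\<bar> \<le> 2 * \<epsilon>"
  shows "K \<le> k \<Longrightarrow> k \<le> Y \<Longrightarrow> k \<notin> M \<Longrightarrow> \<bar>real (\<alpha> k) * (\<theta> - \<theta>')\<bar> \<le> 2 * \<epsilon>"
proof (induction k rule: less_induct)
  case (less k)
  show ?case
  proof (cases "k = K")
    case True
    then show ?thesis using start by simp
  next
    case False
    have step: "real (\<alpha> (Suc j)) \<le> C * real (\<alpha> j)" for j
      using ratio[of j] by (simp add: \<alpha>_def)
    obtain j where j: "K \<le> j" "j < k" "j \<notin> M" "real (\<alpha> k) \<le> C\<^sup>2 * real (\<alpha> j)"
    proof (cases "k - 1 \<in> M")
      case True
      then have "k - 1 \<noteq> K" using K by auto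
      define j where "j = k - 2"
      have k: "k = Suc (Suc j)" "K \<le> j"
        using False less.prems(1) \<open>k - 1 \<noteq> K\<close> by (simp_all add: j_def)
      have "j \<notin> M" using sparse[of j] True k(1) by simp
      moreover have "real (\<alpha> k) \<le> C\<^sup>2 * real (\<alpha> j)"
      proof -
        have "real (\<alpha> k) \<le> C * real (\<alpha> (Suc j))" using step[of "Suc j"] k(1) by simp
        also have "\<dots> \<le> C * (C * real (\<alpha> j))" using step[of j] C_gt_1 by (intro mult_left_mono) auto
        finally show ?thesis by (simp add: power2_eq_square mult.assoc)
      qed
      ultimately show ?thesis using that[of j] k by simp
    next
      case notM: False
      have k: "k = Suc (k - 1)" using False less.prems(1) by simp
      then have "real (\<alpha> k) \<le> C * real (\<alpha> (k - 1))" using step[of "k - 1"] by simp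
      also have "\<dots> \<le> C\<^sup>2 * real (\<alpha> (k - 1))"
        using C_gt_1 by (intro mult_right_mono) (auto simp: power2_eq_square)
      finally show ?thesis using that[of "k - 1"] notM False less.prems(1) by auto
    qed
    have "\<bar>real (\<alpha> k) * (\<theta> - \<theta>')\<bar> \<le> C\<^sup>2 * \<bar>real (\<alpha> j) * (\<theta> - \<theta>')\<bar>"
      using mult_right_mono[OF j(4), of "\<bar>\<theta> - \<theta>'\<bar>"] by (simp add: abs_mult mult_ac)
    also have "\<dots> \<le> C\<^sup>2 * (2 * \<epsilon>)"
      using less.IH[OF j(2,1)] j less.prems by (intro mult_left_mono) auto
    finally have quarter: "\<bar>real (\<alpha> k) * (\<theta> - \<theta>')\<bar> \<le> 1 / 4" using \<epsilon>_bounds(3) by simp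
    define n where "n = round (real (\<alpha> k) * \<theta>) - round (real (\<alpha> k) * \<theta>')"
    have near: "\<bar>real (\<alpha> k) * (\<theta> - \<theta>') - of_int n\<bar> \<le> 2 * \<epsilon>"
      using small[OF less.prems] unfolding dist_nearest_int_def n_def right_diff_distrib of_int_diff
      by linarith
    then have "\<bar>real_of_int n\<bar> < 1" using quarter \<epsilon>_bounds(2) by linarith
    then have "n = 0" by linarith
    then show ?thesis using near by simp
  qed
qed

text \<open>
  By rigidity along all blocks, two such frequencies with distance at most \<open>2 * \<epsilon> / \<alpha> K\<close> are equal,
  because \<open>\<alpha> k\<close> is unbounded.
\<close>

lemma finite_small_frequencies:
  "finite {\<theta>. 0 \<le> \<theta> \<and> \<theta> \<le> 1 \<and> (\<forall>k\<ge>K. dist_nearest_int (real (\<alpha> k) * \<theta>) \<le> \<epsilon>)}" (is "finite ?B")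
proof -
  have eq: "\<theta> = \<theta>'" if "\<theta> \<in> ?B" "\<theta>' \<in> ?B" "\<bar>real (\<alpha> K) * (\<theta> - \<theta>')\<bar> \<le> 2 * \<epsilon>" for \<theta> \<theta>'
  proof (rule ccontr)
    assume "\<theta> \<noteq> \<theta>'"
    then obtain m :: nat where m: "1 < real m * \<bar>\<theta> - \<theta>'\<bar>"
      using reals_Archimedean3[of "\<bar>\<theta> - \<theta>'\<bar>"] by auto
    have "\<bar>real (\<alpha> (K + m)) * (\<theta> - \<theta>')\<bar> \<le> 2 * \<epsilon>"
      by (rule rigidity[where M = "{}" and K = K and Y = "K + m"]) (use that in auto)
    moreover have "real m * \<bar>\<theta> - \<theta>'\<bar> \<le> real (\<alpha> (K + m)) * \<bar>\<theta> - \<theta>'\<bar>"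
      using index_less_\<alpha>[of "K + m"] by (intro mult_right_mono) auto
    ultimately show False using m \<epsilon>_bounds(2) by (simp add: abs_mult)
  qed
  let ?h = "\<lambda>\<theta>. \<lfloor>real (\<alpha> K) * \<theta> / (2 * \<epsilon>)\<rfloor>"
  have "inj_on ?h ?B"
  proof (rule inj_onI)
    fix \<theta> \<theta>' assume B: "\<theta> \<in> ?B" "\<theta>' \<in> ?B" and "?h \<theta> = ?h \<theta>'"
    then have "\<bar>real (\<alpha> K) * \<theta> / (2 * \<epsilon>) - real (\<alpha> K) * \<theta>' / (2 * \<epsilon>)\<bar> < 1" by linarith
    then have "\<bar>real (\<alpha> K) * (\<theta> - \<theta>')\<bar> / (2 * \<epsilon>) < 1"
      using \<epsilon>_bounds(1) by (simp add: right_diff_distrib flip: diff_divide_distrib)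
    then show "\<theta> = \<theta>'" using eq[OF B] \<epsilon>_bounds(1) by simp
  qed
  moreover have "?h ` ?B \<subseteq> {0..\<lfloor>real (\<alpha> K) / (2 * \<epsilon>)\<rfloor>}"
    using \<epsilon>_bounds(1) by (auto intro!: floor_mono divide_right_mono mult_left_le)
  ultimately show ?thesis by (meson finite_atLeastAtMost_int finite_imageD finite_subset)
qed

lemma small_frequencies_compactness:
  assumes "\<tau> > 0"
  shows "\<exists>K'\<ge>K. \<forall>\<theta>. x \<le> \<theta> \<and> \<theta> \<le> y \<and> (\<forall>k. K \<le> k \<and> k \<le> K' \<longrightarrow> dist_nearest_int (real (\<alpha> k) * \<theta>) \<le> \<epsilon>) \<longrightarrow>
    (\<exists>b. x \<le> b \<and> b \<le> y \<and> (\<forall>k\<ge>K. dist_nearest_int (real (\<alpha> k) * b) \<le> \<epsilon>) \<and> \<bar>\<theta> - b\<bar> < \<tau>)"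
proof -
  let ?B = "{b. x \<le> b \<and> b \<le> y \<and> (\<forall>k\<ge>K. dist_nearest_int (real (\<alpha> k) * b) \<le> \<epsilon>)}"
  let ?S = "{x..y} - (\<Union>b\<in>?B. ball b \<tau>)"
  let ?O = "\<lambda>k. {\<theta>. \<epsilon> < dist_nearest_int (real (\<alpha> k) * \<theta>)}"
  have "compact ?S" by (intro compact_diff open_UN) auto
  moreover have "open (?O k)" for k
    by (intro open_Collect_less continuous_intros
        continuous_on_compose2[OF continuous_on_dist_nearest_int[of UNIV]]) auto
  moreover have "?S \<subseteq> (\<Union>k\<in>{K..}. ?O k)"
  proof
    fix \<theta> assume t: "\<theta> \<in> ?S"
    then have "\<theta> \<notin> ?B" using assms by force
    then show "\<theta> \<in> (\<Union>k\<in>{K..}. ?O k)" using t by force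
  qed
  ultimately obtain T where T: "T \<subseteq> {K..}" "finite T" "?S \<subseteq> (\<Union>k\<in>T. ?O k)"
    by (rule compactE_image)
  obtain K0 where K0: "\<forall>k\<in>T. k \<le> K0" using T(2) finite_nat_set_iff_bounded_le by blast
  show ?thesis
  proof (intro exI[of _ "max K K0"] conjI allI impI)
    fix \<theta> assume t: "x \<le> \<theta> \<and> \<theta> \<le> y \<and> (\<forall>k. K \<le> k \<and> k \<le> max K K0 \<longrightarrow> dist_nearest_int (real (\<alpha> k) * \<theta>) \<le> \<epsilon>)"
    have "\<theta> \<notin> ?S"
    proof
      assume "\<theta> \<in> ?S"
      then obtain k where k: "k \<in> T" "\<epsilon> < dist_nearest_int (real (\<alpha> k) * \<theta>)" using T(3) by blast
      moreover have "K \<le> k" "k \<le> max K K0" using k(1) T(1) K0 by auto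
      ultimately show False using t by force
    qed
    then obtain b where "b \<in> ?B" "\<theta> \<in> ball b \<tau>" using t by auto
    then show "\<exists>b. x \<le> b \<and> b \<le> y \<and> (\<forall>k\<ge>K. dist_nearest_int (real (\<alpha> k) * b) \<le> \<epsilon>) \<and> \<bar>\<theta> - b\<bar> < \<tau>"
      by (auto simp: dist_real_def abs_minus_commute)
  qed simp
qed


subsection \<open>Families of sums that detect all frequencies\<close>

lemma colouring: "\<exists>h. (\<forall>a\<in>D k. h a \<le> r) \<and> {..r} \<subseteq> h ` D k"
proof -
  obtain T where T: "T \<subseteq> D k" "card T = r + 1" "finite T"
    using obtain_subset_with_card_n[OF card_D] by metis
  obtain f where f: "bij_betw f T {0..<r + 1}"
    using ex_bij_betw_finite_nat[OF T(3)] T(2) by auto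
  show ?thesis
  proof (intro exI[of _ "\<lambda>a. min r (f a)"] conjI subsetI)
    fix c assume "c \<in> {..r}"
    then have "c \<in> f ` T" using f by (auto simp: bij_betw_def)
    then show "c \<in> (\<lambda>a. min r (f a)) ` D k" using T(1) \<open>c \<in> {..r}\<close> by force
  qed auto
qed

text \<open>
  The divergent sum over the late blocks splits into finitely many parts, one for each parity of the block index
  and each colour, so it diverges on one of them. A sum taken from a single colour leaves the other \<open>r\<close> colours
  of each block untouched, and a single parity leaves a gap after each block that it meets.
\<close>

lemma far_sum_in_one_colour:
  assumes "\<theta> \<notin> \<int>"
  shows "\<exists>P p. finite P \<and> P \<subseteq> (\<Union>k\<in>{K..}. D k) \<and> (\<forall>k. D k \<inter> P \<noteq> {} \<longrightarrow> k mod 2 = p) \<and>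
    (\<forall>k. r \<le> card (D k - P)) \<and> 1 / 4 \<le> dist_nearest_int (real (\<Sum>P) * \<theta>)"
proof -
  obtain h where h: "\<And>k a. a \<in> D k \<Longrightarrow> h k a \<le> r" "\<And>k. {..r} \<subseteq> h k ` D k"
    using colouring by metis
  define Z where "Z p c = {a. \<exists>k\<ge>K. k mod 2 = p \<and> a \<in> D k \<and> h k a = c}" for p c :: nat
  let ?f = "\<lambda>a::nat. dist_nearest_int (real a * \<theta>)"
  have "(\<Union>k\<in>{K..}. D k) \<subseteq> \<Union>((\<lambda>(p, c). Z p c) ` ({..<2} \<times> {..r}))"
    using h(1) by (fastforce simp: Z_def)
  then have "\<not> ?f summable_on \<Union>((\<lambda>(p, c). Z p c) ` ({..<2} \<times> {..r}))"
    using divergent[OF assms, of K] summable_on_subset by blast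
  then have "\<exists>Z'\<in>(\<lambda>(p, c). Z p c) ` ({..<2} \<times> {..r}). \<not> ?f summable_on Z'"
    using summable_on_finite_Union[of "(\<lambda>(p, c). Z p c) ` ({..<2} \<times> {..r})" ?f] by blast
  then obtain p c where pc: "c \<le> r" "\<not> ?f summable_on Z p c"
    by auto
  obtain P where P: "finite P" "P \<subseteq> Z p c" "1 / 4 \<le> dist_nearest_int (real (\<Sum>P) * \<theta>)"
    using nonsummable_imp_far_subset_sum[OF pc(2)] by blast
  have in_block: "k mod 2 = p \<and> h k a = c" if "a \<in> D k" "a \<in> P" for a k
    using that P(2) D_index_unique unfolding Z_def by blast
  have "r \<le> card (D k - P)" for k
  proof -
    have "{..r} - {c} \<subseteq> h k ` (D k - P)"
    proof
      fix c' assume "c' \<in> {..r} - {c}"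
      then obtain a where "a \<in> D k" "h k a = c'" "c' \<noteq> c" using h(2)[of k] by blast
      then show "c' \<in> h k ` (D k - P)" using in_block[of a k] by blast
    qed
    then have "card ({..r} - {c}) \<le> card (D k - P)"
      using finite_D by (meson finite_Diff surj_card_le)
    then show ?thesis using pc(1) by simp
  qed
  moreover have "P \<subseteq> (\<Union>k\<in>{K..}. D k)" using P(2) by (auto simp: Z_def)
  ultimately show ?thesis using P in_block by (intro exI[of _ P] exI[of _ p]) blast
qed

text \<open>
  The windows for different frequencies may use different parities, so one block is skipped between them.
\<close>

lemma far_sums_in_separated_windows:
  assumes "finite B" "B \<inter> \<int> = {}"
  shows "\<exists>P Y. K \<le> Y \<and>
    (\<forall>b\<in>B. finite (P b) \<and> P b \<subseteq> (\<Union>k\<in>{K..<Y}. D k) \<and> 1 / 4 \<le> dist_nearest_int (real (\<Sum>(P b)) * b)) \<and>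
    (\<forall>b\<in>B. \<forall>b'\<in>B. b \<noteq> b' \<longrightarrow> P b \<inter> P b' = {}) \<and>
    (\<forall>k. r \<le> card (D k - \<Union>(P ` B))) \<and>
    (\<forall>k. D k \<inter> \<Union>(P ` B) = {} \<or> D (Suc k) \<inter> \<Union>(P ` B) = {})"
  using assms
proof (induction B rule: finite_induct)
  case empty
  have "r \<le> card (D k)" for k using card_D[of k] by simp
  then show ?case by (intro exI[of _ "\<lambda>_. {}"] exI[of _ K]) simp
next
  case (insert b B)
  have "B \<inter> \<int> = {}" using insert.prems by blast
  from insert.IH[OF this] obtain P Y where Y: "K \<le> Y"
    and P: "\<forall>b\<in>B. finite (P b) \<and> P b \<subseteq> (\<Union>k\<in>{K..<Y}. D k) \<and> 1 / 4 \<le> dist_nearest_int (real (\<Sum>(P b)) * b)"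
    and Pd: "\<forall>b\<in>B. \<forall>b'\<in>B. b \<noteq> b' \<longrightarrow> P b \<inter> P b' = {}"
    and Pc: "\<forall>k. r \<le> card (D k - \<Union>(P ` B))"
    and Ps: "\<forall>k. D k \<inter> \<Union>(P ` B) = {} \<or> D (Suc k) \<inter> \<Union>(P ` B) = {}"
    by (elim exE conjE) (rule that)
  have P_fin: "finite (P b')" and P_far: "1 / 4 \<le> dist_nearest_int (real (\<Sum>(P b')) * b')"
    and P_sub: "P b' \<subseteq> (\<Union>k\<in>{K..<Y}. D k)" if "b' \<in> B" for b'
    using P that by blast+
  obtain P' p where P': "finite P'" "P' \<subseteq> (\<Union>k\<in>{Suc Y..}. D k)" "\<And>k. D k \<inter> P' \<noteq> {} \<Longrightarrow> k mod 2 = p"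
    "\<And>k. r \<le> card (D k - P')" "1 / 4 \<le> dist_nearest_int (real (\<Sum>P') * b)"
    using far_sum_in_one_colour[of b "Suc Y"] insert.prems by blast
  define Y' where "Y' = Suc Y + \<Sum>P'"
  let ?U = "\<Union>(P ` B)"
  let ?P = "P(b := P')"
  have U: "\<Union>(?P ` insert b B) = ?U \<union> P'"
  proof -
    have "?P ` B = P ` B" using insert.hyps(2) by (intro image_cong) auto
    then show ?thesis by (simp only: image_insert Union_insert fun_upd_same Un_commute)
  qed
  have "?U \<subseteq> (\<Union>k\<in>{K..<Y}. D k)" using P_sub by (rule UN_least)
  then have late: "D k \<inter> ?U = {}" if "Y \<le> k" for k
    by (rule D_disjoint_UN) (use that in simp)
  have early: "D k \<inter> P' = {}" if "k \<le> Y" for k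
    using P'(2) by (rule D_disjoint_UN) (use that in simp)
  have P'_sub: "P' \<subseteq> (\<Union>k\<in>{K..<Y'}. D k)"
  proof
    fix a assume a: "a \<in> P'"
    then obtain k where k: "Suc Y \<le> k" "a \<in> D k" using P'(2) by auto
    have "a \<le> \<Sum>P'" using member_le_sum[OF a, of "\<lambda>a. a"] P'(1) by simp
    then have "k < Y'" using index_less[OF k(2)] by (simp add: Y'_def)
    then show "a \<in> (\<Union>k\<in>{K..<Y'}. D k)" using k Y by auto
  qed
  show ?case
  proof (intro exI[of _ ?P] exI[of _ Y'] conjI ballI allI impI)
    show "K \<le> Y'" using Y by (simp add: Y'_def)
  next
    fix b' assume b': "b' \<in> insert b B"
    show "finite (?P b')" using b' P_fin P'(1) by (cases "b' = b") simp_all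
    show "1 / 4 \<le> dist_nearest_int (real (\<Sum>(?P b')) * b')"
      using b' P_far P'(5) by (cases "b' = b") simp_all
    have "(\<Union>k\<in>{K..<Y}. D k) \<subseteq> (\<Union>k\<in>{K..<Y'}. D k)"
      by (intro UN_mono) (auto simp: Y'_def)
    then have "P b' \<subseteq> (\<Union>k\<in>{K..<Y'}. D k)" if "b' \<in> B"
      using P_sub[OF that] by (rule order_trans[rotated])
    then show "?P b' \<subseteq> (\<Union>k\<in>{K..<Y'}. D k)" using b' P'_sub by (cases "b' = b") simp_all
  next
    have PP': "P b' \<inter> P' = {}" if "b' \<in> B" for b'
    proof -
      have "P b' \<subseteq> (\<Union>k\<in>{K..<Y}. D k)" using P_sub that .
      moreover have "D k \<inter> P' = {}" if "k \<in> {K..<Y}" for k using early[of k] that by simp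
      then have "(\<Union>k\<in>{K..<Y}. D k) \<inter> P' = {}" by blast
      ultimately show ?thesis by blast
    qed
    fix b1 b2 assume "b1 \<in> insert b B" "b2 \<in> insert b B" "b1 \<noteq> b2"
    then show "?P b1 \<inter> ?P b2 = {}"
      using PP' Int_commute[of P'] by (cases "b1 = b"; cases "b2 = b") (simp_all add: Pd)
  next
    fix k
    show "r \<le> card (D k - \<Union>(?P ` insert b B))"
    proof (cases "k \<le> Y")
      case True
      then have "D k - (?U \<union> P') = D k - ?U" using early[of k] by (simp add: Diff_Un Diff_triv Int_absorb2)
      then show ?thesis unfolding U using Pc by simp
    next
      case False
      then have "D k - (?U \<union> P') = D k - P'" using late[of k] by (simp add: Diff_Un Diff_triv Int_absorb1)
      then show ?thesis unfolding U using P'(4) by simp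
    qed
    show "D k \<inter> \<Union>(?P ` insert b B) = {} \<or> D (Suc k) \<inter> \<Union>(?P ` insert b B) = {}"
    proof (cases "k < Y")
      case True
      then have e: "D k \<inter> P' = {}" "D (Suc k) \<inter> P' = {}" using early by simp_all
      show ?thesis unfolding U Int_Un_distrib e Un_empty_right by (rule spec[OF Ps])
    next
      case False
      then have e: "D k \<inter> ?U = {}" "D (Suc k) \<inter> ?U = {}" using late by simp_all
      have "k mod 2 \<noteq> Suc k mod 2" by presburger
      then have "D k \<inter> P' = {} \<or> D (Suc k) \<inter> P' = {}"
        using P'(3)[of k] P'(3)[of "Suc k"] by metis
      then show ?thesis unfolding U Int_Un_distrib e Un_empty_left .
    qed
  qed
qed

definition detects :: "nat \<Rightarrow> nat set set \<Rightarrow> bool" where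
  "detects N \<P> \<longleftrightarrow> finite \<P> \<and> disjoint \<P> \<and> (\<forall>P\<in>\<P>. finite P) \<and>
    (\<forall>\<theta>. 1 / real N \<le> \<theta> \<and> \<theta> \<le> 1 - 1 / real N \<longrightarrow> (\<exists>P\<in>\<P>. \<epsilon> \<le> dist_nearest_int (real (\<Sum>P) * \<theta>)))"

lemma detects_mono:
  assumes "detects N \<P>" "1 \<le> M" "M \<le> N"
  shows "detects M \<P>"
proof -
  have "1 / real N \<le> 1 / real M" using assms(2,3) by (simp add: frac_le)
  then have "1 / real N \<le> \<theta> \<and> \<theta> \<le> 1 - 1 / real N"
    if "1 / real M \<le> \<theta> \<and> \<theta> \<le> 1 - 1 / real M" for \<theta> using that by linarith
  then show ?thesis using assms(1) unfolding detects_def by blast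
qed

text \<open>
  The family consists of one far sum for each of the finitely many frequencies \<open>b\<close> that evade the block minima
  from \<open>K\<close> on, and of the minima of the blocks up to \<open>Y\<close> that these sums do not meet. If \<open>\<theta>\<close> evades all
  of these minima, then \<open>\<theta>\<close> is close to some \<open>b\<close> by compactness, and rigidity improves this to a
  distance of order \<open>1 / \<alpha> Y\<close>. For large \<open>Y\<close> this is so small that the far sum of \<open>b\<close> detects \<open>\<theta>\<close> as well.
\<close>

lemma detecting_family:
  assumes N: "N \<ge> 1"
  shows "\<exists>\<P> Y. K \<le> Y \<and> detects N \<P> \<and> \<Union>\<P> \<subseteq> (\<Union>k\<in>{K..Y}. D k) \<and> (\<forall>k. r \<le> card (D k - \<Union>\<P>))"
proof -
  let ?x = "1 / real N"
  let ?y = "1 - 1 / real N"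
  define B where "B = {b. ?x \<le> b \<and> b \<le> ?y \<and> (\<forall>k\<ge>K. dist_nearest_int (real (\<alpha> k) * b) \<le> \<epsilon>)}"
  have x_pos: "0 < ?x" using N by simp
  have range: "0 < b \<and> b < 1" if "b \<in> B" for b
    using that x_pos unfolding B_def mem_Collect_eq by linarith
  have "finite B"
    by (rule finite_subset[OF _ finite_small_frequencies[of K]]) (use range in \<open>auto simp: B_def less_imp_le\<close>)
  have "B \<inter> \<int> = {}"
  proof -
    have "b \<notin> \<int>" if "b \<in> B" for b
      using range[OF that] by (auto elim!: Ints_cases)
    then show ?thesis by blast
  qed
  define \<tau> where "\<tau> = 2 * \<epsilon> / real (\<alpha> K)"
  have "\<tau> > 0" using \<epsilon>_bounds(1) \<alpha>_pos by (simp add: \<tau>_def)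
  then obtain K1 where K1: "K1 \<ge> K" and close: "\<And>\<theta>. ?x \<le> \<theta> \<Longrightarrow> \<theta> \<le> ?y \<Longrightarrow>
      (\<And>k. K \<le> k \<Longrightarrow> k \<le> K1 \<Longrightarrow> dist_nearest_int (real (\<alpha> k) * \<theta>) \<le> \<epsilon>) \<Longrightarrow> \<exists>b\<in>B. \<bar>\<theta> - b\<bar> < \<tau>"
    using small_frequencies_compactness[of \<tau> K ?x ?y] unfolding B_def by blast
  from far_sums_in_separated_windows[OF \<open>finite B\<close> \<open>B \<inter> \<int> = {}\<close>, of "Suc K1"]
  obtain P Y0 where Y0: "Suc K1 \<le> Y0"
    and P: "\<forall>b\<in>B. finite (P b) \<and> P b \<subseteq> (\<Union>k\<in>{Suc K1..<Y0}. D k) \<and> 1 / 4 \<le> dist_nearest_int (real (\<Sum>(P b)) * b)"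
    and Pd: "\<forall>b\<in>B. \<forall>b'\<in>B. b \<noteq> b' \<longrightarrow> P b \<inter> P b' = {}"
    and Pc: "\<forall>k. r \<le> card (D k - \<Union>(P ` B))"
    and Ps: "\<forall>k. D k \<inter> \<Union>(P ` B) = {} \<or> D (Suc k) \<inter> \<Union>(P ` B) = {}"
    by (elim exE conjE) (rule that)
  have P_fin: "finite (P b)" and P_far: "1 / 4 \<le> dist_nearest_int (real (\<Sum>(P b)) * b)"
    and P_sub: "P b \<subseteq> (\<Union>k\<in>{Suc K1..<Y0}. D k)" if "b \<in> B" for b
    using P that by blast+
  let ?U = "\<Union>(P ` B)"
  define M where "M = {k. D k \<inter> ?U \<noteq> {}}"
  have U_sub: "?U \<subseteq> (\<Union>k\<in>{Suc K1..<Y0}. D k)" using P_sub by (rule UN_least)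
  then have M_range: "Suc K1 \<le> k \<and> k < Y0" if "k \<in> M" for k
    using D_disjoint_UN[of ?U "{Suc K1..<Y0}" k] that unfolding M_def by auto
  define Y where "Y = Y0 + 2 * (\<Sum>b\<in>B. \<Sum>(P b))"
  define S where "S = (\<lambda>k. {\<alpha> k}) ` ({K..Y} - M)"
  define \<P> where "\<P> = P ` B \<union> S"
  have \<alpha>_U: "\<alpha> k \<notin> ?U" if "k \<notin> M" for k
    using that \<alpha>_in_D[of k] unfolding M_def by blast
  have Un: "\<Union>\<P> = ?U \<union> \<alpha> ` ({K..Y} - M)" by (auto simp: \<P>_def S_def)
  have "K \<le> Y" using K1 Y0 by (simp add: Y_def)
  moreover have "\<Union>\<P> \<subseteq> (\<Union>k\<in>{K..Y}. D k)"
  proof -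
    have "(\<Union>k\<in>{Suc K1..<Y0}. D k) \<subseteq> (\<Union>k\<in>{K..Y}. D k)"
      using K1 by (intro UN_mono) (auto simp: Y_def)
    with U_sub have "?U \<subseteq> (\<Union>k\<in>{K..Y}. D k)" by (rule order_trans)
    moreover have "\<alpha> ` ({K..Y} - M) \<subseteq> (\<Union>k\<in>{K..Y}. D k)" using \<alpha>_in_D by auto
    ultimately show ?thesis unfolding Un by (rule Un_least)
  qed
  moreover have "r \<le> card (D k - \<Union>\<P>)" for k
  proof (cases "k \<in> M")
    case True
    then have "D k \<inter> \<alpha> ` ({K..Y} - M) = {}"
      using D_index_unique[OF \<alpha>_in_D, of _ k] by auto
    then have "D k - \<Union>\<P> = D k - ?U"
      unfolding Un by blast
    then show ?thesis using Pc by simp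
  next
    case False
    then have "D k \<inter> ?U = {}" by (simp add: M_def)
    moreover have "D k \<inter> \<alpha> ` ({K..Y} - M) \<subseteq> {\<alpha> k}"
      using D_index_unique[OF \<alpha>_in_D, of _ k] by auto
    ultimately have "D k \<inter> \<Union>\<P> \<subseteq> {\<alpha> k}"
      unfolding Un by blast
    then have "D k - {\<alpha> k} \<subseteq> D k - \<Union>\<P>" by blast
    then have "card (D k - {\<alpha> k}) \<le> card (D k - \<Union>\<P>)"
      using finite_D by (intro card_mono) auto
    then show ?thesis using card_D[of k] \<alpha>_in_D[of k] by simp
  qed
  moreover have "detects N \<P>"
    unfolding detects_def
  proof (intro conjI allI impI ballI)
    show "finite \<P>" using \<open>finite B\<close> by (simp add: \<P>_def S_def)
    show "finite P'" if "P' \<in> \<P>" for P' using that P_fin by (auto simp: \<P>_def S_def)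
    have "disjoint (P ` B)"
      unfolding disjoint_def
    proof (intro ballI impI)
      fix X X' assume "X \<in> P ` B" "X' \<in> P ` B" "X \<noteq> X'"
      then obtain b b' where "b \<in> B" "b' \<in> B" "X = P b" "X' = P b'" "b \<noteq> b'" by auto
      then show "X \<inter> X' = {}" by (simp add: Pd)
    qed
    moreover have "disjoint S" unfolding disjoint_def S_def by auto
    moreover have "?U \<inter> \<Union>S = {}" using \<alpha>_U unfolding S_def by auto
    ultimately show "disjoint \<P>" unfolding \<P>_def by (rule disjoint_union)
  next
    fix \<theta> assume t: "?x \<le> \<theta> \<and> \<theta> \<le> ?y"
    show "\<exists>P\<in>\<P>. \<epsilon> \<le> dist_nearest_int (real (\<Sum>P) * \<theta>)"
    proof (rule ccontr)
      assume "\<not> ?thesis"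
      then have neg: "dist_nearest_int (real (\<Sum>P') * \<theta>) < \<epsilon>" if "P' \<in> \<P>" for P'
        using that by force
      have small: "dist_nearest_int (real (\<alpha> k) * \<theta>) \<le> \<epsilon>" if "K \<le> k" "k \<le> Y" "k \<notin> M" for k
        using neg[of "{\<alpha> k}"] that by (simp add: \<P>_def S_def)
      have "dist_nearest_int (real (\<alpha> k) * \<theta>) \<le> \<epsilon>" if "K \<le> k" "k \<le> K1" for k
        using small[of k] that M_range[of k] Y0 by (force simp: Y_def)
      then obtain b where b: "b \<in> B" "\<bar>\<theta> - b\<bar> < \<tau>" using close t by blast
      have "K \<notin> M" "Y \<notin> M" using M_range[of K] M_range[of Y] K1 by (auto simp: Y_def)
      have start: "\<bar>real (\<alpha> K) * (\<theta> - b)\<bar> \<le> 2 * \<epsilon>"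
        using b(2) \<alpha>_pos[of K] by (simp add: \<tau>_def abs_mult pos_less_divide_eq mult.commute)
      have "\<bar>real (\<alpha> Y) * (\<theta> - b)\<bar> \<le> 2 * \<epsilon>"
      proof (rule rigidity[where M = M and K = K and Y = Y])
        show "k \<notin> M \<or> Suc k \<notin> M" for k using Ps by (auto simp: M_def)
        show "dist_nearest_int (real (\<alpha> k) * \<theta>) \<le> \<epsilon> \<and> dist_nearest_int (real (\<alpha> k) * b) \<le> \<epsilon>"
          if "K \<le> k" "k \<le> Y" "k \<notin> M" for k
          using small[OF that] b(1) that(1) by (simp add: B_def)
      qed (use start \<open>K \<notin> M\<close> \<open>Y \<notin> M\<close> \<open>K \<le> Y\<close> in auto)
      then have end_close: "real (\<alpha> Y) * \<bar>\<theta> - b\<bar> \<le> 2 * \<epsilon>" by (simp add: abs_mult)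
      define G where "G = \<Sum>(P b)"
      have "G \<le> (\<Sum>b\<in>B. \<Sum>(P b))"
        unfolding G_def by (rule member_le_sum[OF b(1)]) (use \<open>finite B\<close> in simp_all)
      then have "2 * G \<le> \<alpha> Y"
        using index_less_\<alpha>[of Y] unfolding Y_def by linarith
      then have "2 * real G \<le> real (\<alpha> Y)" by linarith
      then have "2 * real G * \<bar>\<theta> - b\<bar> \<le> real (\<alpha> Y) * \<bar>\<theta> - b\<bar>"
        by (rule mult_right_mono) simp
      moreover have "\<bar>real G * b - real G * \<theta>\<bar> = real G * \<bar>\<theta> - b\<bar>"
        by (simp add: abs_mult abs_minus_commute flip: right_diff_distrib)
      ultimately have "\<bar>real (\<Sum>(P b)) * b - real (\<Sum>(P b)) * \<theta>\<bar> \<le> \<epsilon>"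
        using end_close unfolding G_def by linarith
      then have "1 / 4 \<le> dist_nearest_int (real (\<Sum>(P b)) * \<theta>) + \<epsilon>"
        using P_far[OF b(1)] dist_nearest_int_lipschitz[of "real (\<Sum>(P b)) * b" "real (\<Sum>(P b)) * \<theta>"]
        by linarith
      moreover have "P b \<in> \<P>" using b(1) by (simp add: \<P>_def)
      ultimately show False using neg[of "P b"] \<epsilon>_bounds(2) by linarith
    qed
  qed
  ultimately show ?thesis by (intro exI[of _ \<P>] exI[of _ Y] conjI allI)
qed

text \<open>
  Detecting families for \<open>N = 1, 2, 3, \<dots>\<close> are placed in consecutive intervals of blocks. As each block meets
  at most one of the families, their union still leaves \<open>r\<close> elements in each block.
\<close>

theorem detecting_set:
  "\<exists>U. U \<subseteq> (\<Union>k. D k) \<and> (\<forall>k. r \<le> card (D k - U)) \<and>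
    (\<forall>N\<ge>1. \<exists>\<P>. detects N \<P> \<and> (\<forall>P\<in>\<P>. P \<subseteq> U \<inter> {N<..}))"
proof -
  have "\<forall>K N. \<exists>\<P> Y. K \<le> Y \<and> detects (Suc N) \<P> \<and> \<Union>\<P> \<subseteq> (\<Union>k\<in>{K..Y}. D k) \<and> (\<forall>k. r \<le> card (D k - \<Union>\<P>))"
    using detecting_family by simp
  then obtain F Y where FY: "\<And>K N. K \<le> Y K N" "\<And>K N. detects (Suc N) (F K N)"
    "\<And>K N. \<Union>(F K N) \<subseteq> (\<Union>k\<in>{K..Y K N}. D k)" "\<And>K N k. r \<le> card (D k - \<Union>(F K N))"
    by metis
  define Ks where "Ks = rec_nat 0 (\<lambda>i K. Suc (Y K i))"
  define \<P> where "\<P> i = F (Ks i) i" for i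
  have Ks_Suc: "Ks (Suc i) = Suc (Y (Ks i) i)" for i by (simp add: Ks_def)
  have mono: "strict_mono Ks"
    unfolding strict_mono_Suc_iff using FY(1) by (simp add: Ks_Suc le_imp_less_Suc)
  have \<P>_range: "Ks i \<le> k \<and> k < Ks (Suc i)" if "D k \<inter> \<Union>(\<P> i) \<noteq> {}" for i k
  proof -
    have "k \<in> {Ks i..Y (Ks i) i}"
      using D_disjoint_UN[OF FY(3)[of "Ks i" i], of k] that unfolding \<P>_def by blast
    then show ?thesis by (simp add: Ks_Suc)
  qed
  have unique: "i = j" if "D k \<inter> \<Union>(\<P> i) \<noteq> {}" "D k \<inter> \<Union>(\<P> j) \<noteq> {}" for i j k
  proof -
    have "Ks i < Ks (Suc j)" "Ks j < Ks (Suc i)"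
      using \<P>_range[OF that(1)] \<P>_range[OF that(2)] by auto
    then show ?thesis by (simp add: strict_mono_less[OF mono])
  qed
  define U where "U = (\<Union>i. \<Union>(\<P> i))"
  show ?thesis
  proof (intro exI[of _ U] conjI allI impI)
    show "U \<subseteq> (\<Union>k. D k)" using FY(3) unfolding U_def \<P>_def by blast
  next
    fix k
    show "r \<le> card (D k - U)"
    proof (cases "D k \<inter> U = {}")
      case True
      then have "D k - U = D k" by blast
      then show ?thesis using card_D[of k] by simp
    next
      case False
      then obtain i where i: "D k \<inter> \<Union>(\<P> i) \<noteq> {}" unfolding U_def by blast
      have "a \<in> \<Union>(\<P> i)" if a: "a \<in> D k" "a \<in> U" for a
      proof -
        obtain j where j: "a \<in> \<Union>(\<P> j)" using a(2) unfolding U_def by blast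
        then have "j = i" using unique[OF i, of j] a(1) by blast
        then show ?thesis using j by simp
      qed
      then have "D k - U = D k - \<Union>(\<P> i)" unfolding U_def by blast
      then show ?thesis using FY(4) by (simp add: \<P>_def)
    qed
  next
    fix N :: nat assume N: "1 \<le> N"
    have "detects N (\<P> N)"
      using detects_mono[OF FY(2)[of N "Ks N"] N] by (simp add: \<P>_def)
    moreover have "P \<subseteq> U \<inter> {N<..}" if "P \<in> \<P> N" for P
    proof
      fix a assume a: "a \<in> P"
      then have "a \<in> \<Union>(F (Ks N) N)" using that by (auto simp: \<P>_def)
      then have "a \<in> (\<Union>k\<in>{Ks N..Y (Ks N) N}. D k)" using FY(3) by (rule subsetD[rotated])
      then obtain k where k: "a \<in> D k" "Ks N \<le> k" by auto
      have "N \<le> Ks N" using mono by (rule strict_mono_imp_increasing)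
      then have "N < a" using index_less[OF k(1)] k(2) by simp
      then show "a \<in> U \<inter> {N<..}" using a that by (auto simp: U_def)
    qed
    ultimately show "\<exists>\<P>. detects N \<P> \<and> (\<forall>P\<in>\<P>. P \<subseteq> U \<inter> {N<..})" by blast
  qed
qed

end

section \<open>Greedy representations\<close>

text \<open>
  Subset sums that approximate every number up to \<open>c + \<Sum>F\<close> from below within \<open>c\<close> keep doing so when an element \<open>a\<close>
  not exceeding this bound is added: a number beyond the bound is at least \<open>a\<close>, so \<open>a\<close> can be subtracted.
\<close>

lemma greedy_insert:
  assumes "finite F" "a \<notin> F" "a \<le> c + \<Sum>F"
    and IH: "\<And>x. x \<le> c + \<Sum>F \<Longrightarrow> \<exists>s\<in>subset_sums F. s \<le> x \<and> x \<le> s + c"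
    and x: "x \<le> c + \<Sum>(insert a F)"
  shows "\<exists>s\<in>subset_sums (insert a F). s \<le> x \<and> x \<le> s + c"
proof (cases "x \<le> c + \<Sum>F")
  case True
  then show ?thesis using IH subset_sums_mono[of F "insert a F"] by blast
next
  case False
  then have "a \<le> x" "x - a \<le> c + \<Sum>F" using assms by simp_all
  then obtain s where s: "s \<in> subset_sums F" "s \<le> x - a" "x - a \<le> s + c" using IH by blast
  then obtain G where G: "finite G" "G \<subseteq> F" "s = \<Sum>G" unfolding subset_sums_def by blast
  have "a \<notin> G" using G(2) assms(2) by blast
  then have "s + a = \<Sum>(insert a G)" using G by simp
  moreover have "finite (insert a G)" "insert a G \<subseteq> insert a F" using G by auto
  ultimately have "s + a \<in> subset_sums (insert a F)" unfolding subset_sums_def by blast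
  then show ?thesis using s(2,3) \<open>a \<le> x\<close> by (intro bexI[of _ "s + a"]) auto
qed

lemma greedy_union:
  assumes "finite H" "finite F" "F \<inter> H = {}" "\<And>a. a \<in> H \<Longrightarrow> a \<le> c + \<Sum>F"
    and "\<And>x. x \<le> c + \<Sum>F \<Longrightarrow> \<exists>s\<in>subset_sums F. s \<le> x \<and> x \<le> s + c"
  shows "x \<le> c + \<Sum>(F \<union> H) \<Longrightarrow> \<exists>s\<in>subset_sums (F \<union> H). s \<le> x \<and> x \<le> s + c"
  using assms(1,3,4)
proof (induction H arbitrary: x rule: finite_induct)
  case empty
  then show ?case using assms(5) by simp
next
  case (insert a H)
  have "\<Sum>F \<le> \<Sum>(F \<union> H)" using assms(2) insert.hyps(1) by (intro sum_mono2) auto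
  moreover have "a \<le> c + \<Sum>F" using insert.prems(3) by simp
  ultimately have a: "a \<le> c + \<Sum>(F \<union> H)" by linarith
  have Un: "F \<union> insert a H = insert a (F \<union> H)" by simp
  show ?case
    unfolding Un
  proof (rule greedy_insert[OF _ _ a])
    show "x \<le> c + \<Sum>(insert a (F \<union> H))" using insert.prems(1) unfolding Un .
    show "\<exists>s\<in>subset_sums (F \<union> H). s \<le> y \<and> y \<le> s + c" if "y \<le> c + \<Sum>(F \<union> H)" for y
      using insert.IH[OF that] insert.prems(2,3) by auto
  qed (use assms(2) insert in auto)
qed

lemma subset_sums_gaps:
  fixes E :: "nat \<Rightarrow> nat set"
  assumes fin: "\<And>k. finite (E k)" and disj: "\<And>k l. k \<noteq> l \<Longrightarrow> E k \<inter> E l = {}"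
    and small: "\<And>k a. a \<in> E k \<Longrightarrow> a \<le> c + (\<Sum>l<k. \<Sum>(E l))"
    and unbdd: "\<And>x. \<exists>k. x \<le> c + (\<Sum>l<k. \<Sum>(E l))"
  shows "\<exists>s\<in>subset_sums (\<Union>k. E k). s \<le> x \<and> x \<le> s + c"
proof -
  have sum_UN: "\<Sum>(\<Union>l<k. E l) = (\<Sum>l<k. \<Sum>(E l))" for k
    using fin disj by (intro sum.UNION_disjoint) auto
  have "\<And>x. x \<le> c + \<Sum>(\<Union>l<k. E l) \<Longrightarrow> \<exists>s\<in>subset_sums (\<Union>l<k. E l). s \<le> x \<and> x \<le> s + c" for k
  proof (induction k)
    case 0
    have "0 \<in> subset_sums {}" unfolding subset_sums_def by (force intro: exI[of _ "{}"])
    then show ?case using 0 by (intro bexI[of _ 0]) auto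
  next
    case (Suc k)
    have Un: "(\<Union>l<Suc k. E l) = (\<Union>l<k. E l) \<union> E k" by (auto simp: lessThan_Suc)
    show ?case
      unfolding Un
    proof (rule greedy_union[OF fin])
      have "E l \<inter> E k = {}" if "l < k" for l using disj[of l k] that by simp
      then show "(\<Union>l<k. E l) \<inter> E k = {}" by blast
    qed (use fin small Suc sum_UN in \<open>auto simp: Un\<close>)
  qed
  moreover obtain k where "x \<le> c + (\<Sum>l<k. \<Sum>(E l))" using unbdd by blast
  ultimately obtain s where "s \<in> subset_sums (\<Union>l<k. E l)" "s \<le> x \<and> x \<le> s + c"
    unfolding sum_UN[symmetric] by blast
  moreover have "subset_sums (\<Union>l<k. E l) \<subseteq> subset_sums (\<Union>k. E k)"
    by (intro subset_sums_mono) auto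
  ultimately show ?thesis by blast
qed

lemma dense_windows_of_gaps:
  assumes "\<And>x. \<exists>s\<in>W. s \<le> x \<and> x \<le> s + c"
  shows "dense_windows W (1 / (2 * (real c + 1)))"
  unfolding dense_windows_def
proof (intro allI impI)
  fix X :: nat assume X: "X \<ge> 1"
  define M where "M = X div (c + 1)"
  have hit: "1 \<le> card (W \<inter> {x..<x + (c + 1)})" for x
  proof -
    obtain s where "s \<in> W" "s \<le> x + c" "x + c \<le> s + c" using assms by blast
    then have "W \<inter> {x..<x + (c + 1)} \<noteq> {}" by auto
    then have "card (W \<inter> {x..<x + (c + 1)}) \<noteq> 0" by simp
    then show ?thesis by linarith
  qed
  have many: "m \<le> card (W \<inter> {x..<x + (c + 1) * m})" for m x
  proof (induction m)
    case (Suc m)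
    let ?y = "x + (c + 1) * m"
    have "W \<inter> {x..<x + (c + 1) * Suc m} = (W \<inter> {x..<?y}) \<union> (W \<inter> {?y..<?y + (c + 1)})"
      by auto
    moreover have "card ((W \<inter> {x..<?y}) \<union> (W \<inter> {?y..<?y + (c + 1)}))
        = card (W \<inter> {x..<?y}) + card (W \<inter> {?y..<?y + (c + 1)})"
      by (rule card_Un_disjoint) auto
    ultimately show ?case using Suc.IH hit[of ?y] by simp
  qed simp
  show "\<exists>x. 1 / (2 * (real c + 1)) * real X \<le> real (card (W \<inter> {x..<x + X}))"
  proof (cases "M = 0")
    case True
    then have "X \<le> c" by (simp add: M_def div_eq_0_iff)
    obtain s where "s \<in> W" using assms by blast
    then have "W \<inter> {s..<s + X} \<noteq> {}" using X by auto
    then have "1 \<le> card (W \<inter> {s..<s + X})" by (simp add: Suc_le_eq card_gt_0_iff)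
    moreover have "1 / (2 * (real c + 1)) * real X \<le> 1"
      using \<open>X \<le> c\<close> by (simp add: field_simps)
    ultimately show ?thesis by (intro exI[of _ s]) linarith
  next
    case False
    have le: "(c + 1) * M \<le> X" unfolding M_def by (rule times_div_less_eq_dividend)
    have "X < (c + 1) * (M + 1)"
      unfolding M_def using dividend_less_times_div[of "c + 1" X] by (simp add: algebra_simps)
    also have "\<dots> \<le> (c + 1) * (2 * M)" using False by (intro mult_le_mono2) simp
    finally have "real X \<le> real ((c + 1) * (2 * M))" by (simp only: of_nat_le_iff)
    then have "1 / (2 * (real c + 1)) * real X \<le> real M" by (simp add: field_simps)
    also have "M \<le> card (W \<inter> {0..<0 + (c + 1) * M})" by (rule many)
    also have "\<dots> \<le> card (W \<inter> {0..<0 + X})" using le by (intro card_mono) auto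
    finally show ?thesis by (intro exI[of _ 0]) simp
  qed
qed

section \<open>Completeness\<close>

context block_sequence
begin

text \<open>
  The selected elements of a block are at least its minimum, so the growth condition on block minima
  bounds each element by \<open>c\<close> plus the sum of all elements selected before. The bound \<open>c\<close> is the same for all
  selections.
\<close>

lemma selection_gaps:
  assumes R: "\<And>k. R k \<subseteq> D k" "\<And>k. card (R k) = \<rho> k"
    and bound: "\<And>k. Max (D k) \<le> c + (\<Sum>l<k. \<rho> l * Min (D l))"
  shows "\<exists>s\<in>subset_sums (\<Union>k. R k). s \<le> x \<and> x \<le> s + c"
proof (rule subset_sums_gaps)
  have fin: "finite (R k)" for k using R(1) finite_D finite_subset by blast
  then show "finite (R k)" for k .
  show "R k \<inter> R l = {}" if "k \<noteq> l" for k l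
    using R(1)[of k] R(1)[of l] D_disjoint[OF that] by blast
  have "\<rho> l * Min (D l) \<le> \<Sum>(R l)" for l
  proof -
    have "(\<Sum>a\<in>R l. Min (D l)) \<le> \<Sum>(R l)"
      using R(1)[of l] finite_D by (intro sum_mono) auto
    then show ?thesis using R(2) by simp
  qed
  then have "(\<Sum>l<k. \<rho> l * Min (D l)) \<le> (\<Sum>l<k. \<Sum>(R l))" for k by (intro sum_mono)
  then have Max_le: "Max (D k) \<le> c + (\<Sum>l<k. \<Sum>(R l))" for k
    using bound[of k] add_left_mono order_trans by blast
  show "a \<le> c + (\<Sum>l<k. \<Sum>(R l))" if "a \<in> R k" for a k
  proof -
    have "a \<le> Max (D k)" using R(1) that finite_D by (intro Max_ge) auto
    then show ?thesis using Max_le[of k] by simp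
  qed
  have "x \<le> Max (D x)" for x
    using index_less_\<alpha>[of x] Max_ge[OF finite_D \<alpha>_in_D, of x] by simp
  then show "\<exists>k. x \<le> c + (\<Sum>l<k. \<Sum>(R l))" for x
    using Max_le order_trans by blast
qed

text \<open>
  A density above \<open>1 - 1 / (c + 1)\<close> forces some window of length \<open>c + 1\<close> to be full. Such an interval of
  subset sums of \<open>E1 \<union> V\<close> bridges the gaps between the subset sums of \<open>E2\<close>.
\<close>

theorem block_sums_complete:
  assumes r: "\<And>k. \<rho>1 k + \<rho>2 k = r"
    and bound1: "\<And>k. Max (D k) \<le> c + (\<Sum>l<k. \<rho>1 l * Min (D l))"
    and bound2: "\<And>k. Max (D k) \<le> c + (\<Sum>l<k. \<rho>2 l * Min (D l))"
  shows "\<exists>n0. \<forall>n\<ge>n0. n \<in> subset_sums (\<Union>k. D k)"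
proof -
  obtain U where U: "U \<subseteq> (\<Union>k. D k)" "\<And>k. r \<le> card (D k - U)"
    and det: "\<And>N. N \<ge> 1 \<Longrightarrow> \<exists>\<P>. detects N \<P> \<and> (\<forall>P\<in>\<P>. P \<subseteq> U \<inter> {N<..})"
    using detecting_set by blast
  have "\<exists>R1 R2. R1 \<subseteq> D k - U \<and> R2 \<subseteq> D k - U \<and> R1 \<inter> R2 = {} \<and> card R1 = \<rho>1 k \<and> card R2 = \<rho>2 k" for k
  proof -
    obtain R1 where R1: "R1 \<subseteq> D k - U" "card R1 = \<rho>1 k" "finite R1"
      using obtain_subset_with_card_n[of "\<rho>1 k" "D k - U"] U(2)[of k] r[of k] by auto
    have "\<rho>2 k \<le> card (D k - U - R1)"
      using R1 U(2)[of k] r[of k] by (simp add: card_Diff_subset)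
    then obtain R2 where "R2 \<subseteq> D k - U - R1" "card R2 = \<rho>2 k"
      using obtain_subset_with_card_n by metis
    then show ?thesis using R1 by blast
  qed
  then obtain R1 R2 where R: "\<And>k. R1 k \<subseteq> D k - U" "\<And>k. R2 k \<subseteq> D k - U" "\<And>k. R1 k \<inter> R2 k = {}"
    "\<And>k. card (R1 k) = \<rho>1 k" "\<And>k. card (R2 k) = \<rho>2 k"
    by metis
  have R1: "R1 k \<subseteq> D k" "R1 k \<inter> U = {}" and R2: "R2 k \<subseteq> D k" "R2 k \<inter> U = {}" for k
    using R(1)[of k] R(2)[of k] by blast+
  define E1 E2 where "E1 = (\<Union>k. R1 k)" and "E2 = (\<Union>k. R2 k)"
  have gaps1: "\<exists>s\<in>subset_sums E1. s \<le> x \<and> x \<le> s + c" for x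
    unfolding E1_def by (rule selection_gaps[OF _ R(4) bound1]) (rule R1(1))
  have gaps2: "\<exists>s\<in>subset_sums E2. s \<le> x \<and> x \<le> s + c" for x
    unfolding E2_def by (rule selection_gaps[OF _ R(5) bound2]) (rule R2(1))
  have E_disj: "E1 \<inter> E2 = {}"
  proof (rule ccontr)
    assume "E1 \<inter> E2 \<noteq> {}"
    then obtain a k l where a: "a \<in> R1 k" "a \<in> R2 l" unfolding E1_def E2_def by blast
    then have "a \<in> D k" "a \<in> D l" using R1(1)[of k] R2(1)[of l] by blast+
    then have "k = l" by (rule D_index_unique)
    then show False using a R(3)[of k] by blast
  qed
  have "\<exists>V. finite V \<and> V \<subseteq> U \<and> dense_windows (subset_sums (E1 \<union> V)) (1 - 1 / (2 * (real c + 1)))"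
  proof (rule subset_sums_density_saturates[where e = \<epsilon>])
    show "E1 \<inter> U = {}" unfolding E1_def using R1(2) by (auto simp: disjoint_iff)
    show "dense_windows (subset_sums E1) (1 / (2 * (real c + 1)))"
      using gaps1 by (rule dense_windows_of_gaps)
    show "\<epsilon> > 0" "\<epsilon> \<le> 1 / 2" using \<epsilon>_bounds by simp_all
    fix N :: nat assume "N \<ge> 1"
    from det[OF this] obtain \<P> where "detects N \<P>" "\<forall>P\<in>\<P>. P \<subseteq> U \<inter> {N<..}" by blast
    then show "\<exists>\<P>. finite \<P> \<and> disjoint \<P> \<and> (\<forall>P\<in>\<P>. finite P \<and> P \<subseteq> U \<inter> {N<..}) \<and>
      (\<forall>\<theta>. 1 / real N \<le> \<theta> \<and> \<theta> \<le> 1 - 1 / real N \<longrightarrow> (\<exists>P\<in>\<P>. \<epsilon> \<le> dist_nearest_int (real (\<Sum>P) * \<theta>)))"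
      unfolding detects_def by (intro exI[of _ \<P>] conjI ballI) simp_all
  qed simp_all
  then obtain V where V: "finite V" "V \<subseteq> U"
    and dense: "dense_windows (subset_sums (E1 \<union> V)) (1 - 1 / (2 * (real c + 1)))" by blast
  have "c + 1 \<ge> 1" by simp
  then have "\<exists>x. (1 - 1 / (2 * (real c + 1))) * real (c + 1)
      \<le> real (card (subset_sums (E1 \<union> V) \<inter> {x..<x + (c + 1)}))"
    by (rule dense[unfolded dense_windows_def, rule_format])
  then obtain x where "(1 - 1 / (2 * (real c + 1))) * real (c + 1)
      \<le> real (card (subset_sums (E1 \<union> V) \<inter> {x..<x + (c + 1)}))"
    by blast
  moreover have "(1 - 1 / (2 * (real c + 1))) * real (c + 1) = real c + 1 / 2"
    by (simp add: field_simps)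
  ultimately have "card {x..<x + (c + 1)} \<le> card (subset_sums (E1 \<union> V) \<inter> {x..<x + (c + 1)})"
    unfolding card_atLeastLessThan by linarith
  then have "subset_sums (E1 \<union> V) \<inter> {x..<x + (c + 1)} = {x..<x + (c + 1)}"
    by (intro card_seteq) auto
  then have "{x..<x + (c + 1)} \<subseteq> subset_sums (E1 \<union> V)" by blast
  then have interval: "y \<in> subset_sums (E1 \<union> V)" if "x \<le> y" "y \<le> x + c" for y
    by (rule subsetD) (use that in simp)
  have "n \<in> subset_sums (\<Union>k. D k)" if n: "n \<ge> x" for n
  proof -
    obtain s where s: "s \<in> subset_sums E2" "s \<le> n - x" "n - x \<le> s + c" using gaps2[of "n - x"] by blast
    then have "n - s \<in> subset_sums (E1 \<union> V)" using n by (intro interval) auto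
    then obtain F where F: "finite F" "F \<subseteq> E1 \<union> V" "n - s = \<Sum>F" unfolding subset_sums_def by blast
    obtain G where G: "finite G" "G \<subseteq> E2" "s = \<Sum>G" using s(1) unfolding subset_sums_def by blast
    have "E2 \<inter> U = {}" unfolding E2_def using R2(2) by (auto simp: disjoint_iff)
    then have "(E1 \<union> V) \<inter> E2 = {}" using V(2) E_disj by blast
    then have "F \<inter> G = {}" using F(2) G(2) by blast
    then have "\<Sum>(F \<union> G) = \<Sum>F + \<Sum>G" using F(1) G(1) by (simp add: sum.union_disjoint)
    then have "n = \<Sum>(F \<union> G)" using F(3) G(3) s(2) n by linarith
    moreover have "E1 \<subseteq> (\<Union>k. D k)" "E2 \<subseteq> (\<Union>k. D k)"
      unfolding E1_def E2_def by (rule UN_mono[OF order_refl], rule R1(1), rule UN_mono[OF order_refl], rule R2(1))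
    then have "E1 \<union> V \<union> E2 \<subseteq> (\<Union>k. D k)" using order_trans[OF V(2) U(1)] by (intro Un_least)
    then have "F \<union> G \<subseteq> (\<Union>k. D k)" using F(2) G(2) by (meson Un_mono order_trans)
    ultimately show ?thesis unfolding subset_sums_iff using F(1) G(1) by (intro exI[of _ "F \<union> G"]) simp
  qed
  then show ?thesis by blast
qed

end

lemma H1_trivial_imp_divergent:
  assumes "H1 (int ` A) = {0}" "\<theta> \<notin> \<int>"
  shows "\<not> (\<lambda>a. dist_nearest_int (real a * \<theta>)) summable_on A"
proof
  assume "(\<lambda>a. dist_nearest_int (real a * \<theta>)) summable_on A"
  then have "(\<lambda>s. circle_norm (circle_mult s (abs_circle \<theta>))) summable_on int ` A"
    by (simp add: summable_on_reindex circle_mult.abs_eq circle_norm.abs_eq o_def)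
  then have "abs_circle \<theta> = 0" using assms(1) unfolding H1_def by blast
  then have "\<theta> - 0 \<in> \<int>" by (simp only: zero_circle_def circle.abs_eq_iff)
  then show False using assms(2) by simp
qed

theorem theorem5p1:
  fixes A :: "nat set" and Ak :: "nat \<Rightarrow> nat set"
    and k0 r :: nat and r1 r2 :: "nat \<Rightarrow> nat"
  assumes "0 \<notin> A"
    and "H1 (int ` A) = {0}"
    and "\<And>k. k \<ge> 1 \<Longrightarrow> finite (Ak k) \<and> Ak k \<noteq> {} \<and> Ak k \<subseteq> A"
    and "\<And>k. k \<ge> 1 \<Longrightarrow> Max (Ak k) < Min (Ak (k + 1))"
    and "finite (A - (\<Union>k\<in>{1..}. Ak k))"
    and "k0 \<ge> 1" and "r \<ge> 1"
    and "infinite {k. k \<ge> k0 \<and> r1 k > 0}"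
    and "infinite {k. k \<ge> k0 \<and> r2 k > 0}"
    and "\<And>k. k \<ge> k0 \<Longrightarrow> r1 k + r2 k = r"
    and "\<And>k. k \<ge> k0 \<Longrightarrow> card (Ak k) \<ge> r + 1"
    and "bdd_above ((\<lambda>k. real (Min (Ak (k + 1))) / real (Min (Ak k))) ` {k0..})"
    and "bdd_above ((\<lambda>k. int (Max (Ak k)) - (\<Sum>l = k0..<k. int (r1 l) * int (Min (Ak l)))) ` {k0..})"
    and "bdd_above ((\<lambda>k. int (Max (Ak k)) - (\<Sum>l = k0..<k. int (r2 l) * int (Min (Ak l)))) ` {k0..})"
  shows "strongly_complete A"
  unfolding strongly_complete_def
proof (intro allI impI)
  fix B assume B: "finite B \<and> B \<subseteq> A"
  have Min_in: "Min (Ak k) \<in> Ak k" if "k \<ge> 1" for k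
    using assms(3)[OF that] by (intro Min_in) auto
  have Min_ge: "k \<le> Min (Ak k)" if "k \<ge> 1" for k
    using that
  proof (induction k rule: dec_induct)
    case base
    have "Min (Ak 1) \<in> A" using Min_in[OF order_refl] assms(3)[OF order_refl] by blast
    then have "Min (Ak 1) \<noteq> 0" using assms(1) by metis
    then show ?case by linarith
  next
    case (step k)
    have "Min (Ak k) \<le> Max (Ak k)" using assms(3)[of k] Min_in[of k] step.hyps by (intro Max_ge) auto
    then show ?case using step assms(4)[of k] by simp
  qed
  \<comment> \<open>Elements of the \<open>k\<close>-th block are at least \<open>k\<close>, so from this index on the blocks avoid \<open>B\<close>.\<close>
  define k1 where "k1 = k0 + \<Sum>B + 1"
  define D where "D k = Ak (k1 + k)" for k
  have k1: "k1 \<ge> 1" "k1 \<ge> k0" by (simp_all add: k1_def)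
  obtain C where C0: "\<And>k. k \<ge> k0 \<Longrightarrow> real (Min (Ak (k + 1))) / real (Min (Ak k)) \<le> C"
    using assms(12) by (auto simp: bdd_above_def)
  have C: "real (Min (Ak (k + 1))) \<le> C * real (Min (Ak k))" if "k \<ge> k0" for k
  proof -
    have "0 < real (Min (Ak k))" using Min_ge[of k] that assms(6) by simp
    then show ?thesis using C0[OF that]
      by (simp only: pos_divide_le_eq)
  qed
  interpret block_sequence D r C
  proof
    fix k
    have k: "k1 + k \<ge> 1" "k1 + k \<ge> k0" using k1 by simp_all
    show "finite (D k)" "0 \<notin> D k"
      unfolding D_def using assms(3)[OF k(1)] assms(1) by auto
    show "r + 1 \<le> card (D k)"
      unfolding D_def using k(2) by (rule assms(11))
    show "Max (D k) < Min (D (Suc k))" using assms(4)[OF k(1)] by (simp add: D_def)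
    show "real (Min (D (Suc k))) \<le> C * real (Min (D k))" using C[OF k(2)] by (simp add: D_def)
  next
    fix \<theta> :: real and K assume "\<theta> \<notin> \<int>"
    let ?f = "\<lambda>a. dist_nearest_int (real a * \<theta>)"
    let ?X = "A - (\<Union>k\<in>{1..}. Ak k)" and ?Y = "\<Union>k\<in>{1..<k1 + K}. Ak k" and ?Z = "\<Union>k\<in>{K..}. D k"
    have "A \<subseteq> (?X \<union> ?Y) \<union> ?Z"
    proof
      fix a assume "a \<in> A"
      show "a \<in> (?X \<union> ?Y) \<union> ?Z"
      proof (cases "a \<in> (\<Union>k\<in>{1..}. Ak k)")
        case True
        then obtain k where k: "k \<ge> 1" "a \<in> Ak k" by auto
        show ?thesis
        proof (cases "k < k1 + K")
          case False
          then have "a \<in> D (k - k1)" "K \<le> k - k1" using k by (simp_all add: D_def)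
          then show ?thesis by blast
        qed (use k in auto)
      qed (use \<open>a \<in> A\<close> in blast)
    qed
    moreover have "finite (?X \<union> ?Y)" using assms(3,5) by auto
    ultimately show "\<not> ?f summable_on ?Z"
      using H1_trivial_imp_divergent[OF assms(2) \<open>\<theta> \<notin> \<int>\<close>]
        summable_on_union[of ?f "?X \<union> ?Y" ?Z] summable_on_subset[of ?f "(?X \<union> ?Y) \<union> ?Z" A]
        summable_on_finite[of "?X \<union> ?Y" ?f]
      by blast
  qed
  have shifted_bound: "\<exists>c. \<forall>k. Max (D k) \<le> c + (\<Sum>l<k. \<rho> (k1 + l) * Min (D l))"
    if bdd: "bdd_above ((\<lambda>k. int (Max (Ak k)) - (\<Sum>l = k0..<k. int (\<rho> l) * int (Min (Ak l)))) ` {k0..})" for \<rho>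
  proof -
    obtain c where c: "\<And>k. k \<ge> k0 \<Longrightarrow> int (Max (Ak k)) - (\<Sum>l = k0..<k. int (\<rho> l) * int (Min (Ak l))) \<le> c"
      using bdd by (auto simp: bdd_above_def)
    \<comment> \<open>Starting the blocks at \<open>k1\<close> instead of \<open>k0\<close> loses only a constant amount.\<close>
    define c' where "c' = nat c + (\<Sum>l = k0..<k1. \<rho> l * Min (Ak l))"
    have "Max (D k) \<le> c' + (\<Sum>l<k. \<rho> (k1 + l) * Min (D l))" for k
    proof -
      have "(\<Sum>l = k0..<k1 + k. \<rho> l * Min (Ak l)) =
          (\<Sum>l = k0..<k1. \<rho> l * Min (Ak l)) + (\<Sum>l = k1..<k1 + k. \<rho> l * Min (Ak l))"
        using k1 by (simp add: sum.atLeastLessThan_concat)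
      also have "(\<Sum>l = k1..<k1 + k. \<rho> l * Min (Ak l)) = (\<Sum>l<k. \<rho> (k1 + l) * Min (D l))"
        unfolding D_def by (rule sum.reindex_bij_witness[where i = "\<lambda>l. k1 + l" and j = "\<lambda>l. l - k1"]) auto
      finally have split: "(\<Sum>l = k0..<k1 + k. \<rho> l * Min (Ak l)) =
          (\<Sum>l = k0..<k1. \<rho> l * Min (Ak l)) + (\<Sum>l<k. \<rho> (k1 + l) * Min (D l))" .
      have "int (Max (D k)) - int (\<Sum>l = k0..<k1 + k. \<rho> l * Min (Ak l)) \<le> c"
        using c[of "k1 + k"] k1 by (simp add: D_def)
      then show ?thesis unfolding c'_def split by linarith
    qed
    then show ?thesis by blast
  qed
  obtain c1 c2 where c: "\<And>k. Max (D k) \<le> c1 + (\<Sum>l<k. r1 (k1 + l) * Min (D l))"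
    "\<And>k. Max (D k) \<le> c2 + (\<Sum>l<k. r2 (k1 + l) * Min (D l))"
    using shifted_bound[OF assms(13)] shifted_bound[OF assms(14)] by blast
  have "\<exists>n0. \<forall>n\<ge>n0. n \<in> subset_sums (\<Union>k. D k)"
  proof (rule block_sums_complete)
    show "r1 (k1 + k) + r2 (k1 + k) = r" for k using assms(10) k1 by simp
    show "Max (D k) \<le> (c1 + c2) + (\<Sum>l<k. r1 (k1 + l) * Min (D l))" for k using c(1)[of k] by simp
    show "Max (D k) \<le> (c1 + c2) + (\<Sum>l<k. r2 (k1 + l) * Min (D l))" for k using c(2)[of k] by simp
  qed
  moreover have "(\<Union>k. D k) \<subseteq> A - B"
  proof
    fix a assume "a \<in> (\<Union>k. D k)"
    then obtain k where k: "a \<in> Ak (k1 + k)" by (auto simp: D_def)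
    then have "a \<in> A" using assms(3)[of "k1 + k"] k1 by auto
    have "k1 + k \<le> a" using Min_ge[of "k1 + k"] k k1 assms(3)[of "k1 + k"] Min_le[of "Ak (k1 + k)" a] by simp
    moreover have "b \<le> \<Sum>B" if "b \<in> B" for b
      using member_le_sum[OF that, of "\<lambda>b. b"] B by simp
    ultimately have "a \<notin> B" by (force simp: k1_def)
    then show "a \<in> A - B" using \<open>a \<in> A\<close> by blast
  qed
  then have "subset_sums (\<Union>k. D k) \<subseteq> subset_sums (A - B)" by (rule subset_sums_mono)
  ultimately have "\<exists>n0. \<forall>n\<ge>n0. n \<in> subset_sums (A - B)" by blast
  then show "complete_set (A - B)"
    unfolding complete_set_def eventually_sequentially subset_sums_iff .
qed

end
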